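(* There exist a constant $c>0$, an infinite family of graphs $\{G_n=([n],E_n)\}_{n\in\mathbb{N}}$ such that each $G_n$ is $c\cdot n$-robustly self-ordered (in particular, $|E_n|=\Omega(n^2)$), and an algorithm that, given $n\in\mathbb{N}$ and $u,v\in[n]$ (in binary), determines whether $u$ and $v$ are adjacent in $G_n$ in time polynomial in $\log n$.
   Context: For a graph $G=(V,E)$ and a bijection $\pi:V\to V$, let $\pi(E)=\{\{\pi(u),\pi(v)\}:\{u,v\}\in E\}$. For $\rho>0$, $G$ is $\rho$-robustly self-ordered if for every permutation $\pi:V\to V$, $|E\triangle \pi(E)|\ge \rho\cdot|\{v\in V:\pi(v)\ne v\}|$.
   Formalization: "Each G_n is c·n-robustly self-ordered" is proved for all sufficiently large n; for every n it is false, since each graph on 2 to 5 vertices has a nontrivial automorphism. Finitely many n ≥ 6 can be patched by fixed asymmetric graphs with a smaller c. *)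

theory Defs
  imports
    Complex_Main
    "HOL-Library.Landau_Symbols"
    "HOL-Combinatorics.Permutations"
    "HOL-Computational_Algebra.Polynomial"
begin

section \<open>Robustly self-ordered graphs\<close>

definition simple_graph :: "'a set \<Rightarrow> 'a set set \<Rightarrow> bool" where
  "simple_graph V E \<longleftrightarrow> finite V \<and> (\<forall>e\<in>E. e \<subseteq> V \<and> card e = 2)"

definition permute_edges :: "('a \<Rightarrow> 'a) \<Rightarrow> 'a set set \<Rightarrow> 'a set set" where
  "permute_edges \<pi> E = {\<pi> ` e | e. e \<in> E}"

definition robustly_self_ordered :: "real \<Rightarrow> 'a set \<Rightarrow> 'a set set \<Rightarrow> bool" where
  "robustly_self_ordered \<rho> V E \<longleftrightarrow>
     simple_graph V E \<and> 0 < \<rho> \<and>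
     (\<forall>\<pi>. \<pi> permutes V \<longrightarrow>
        real (card (sym_diff E (permute_edges \<pi> E))) \<ge> \<rho> * real (card {v \<in> V. \<pi> v \<noteq> v}))"

section \<open>Deterministic multi-tape Turing machines\<close>

text \<open>
  Tapes are infinite in both directions; a tape is its contents together with the position of
  its head. Symbols are natural numbers, and symbol 0 is the blank.
\<close>

type_synonym tape = "(int \<Rightarrow> nat) \<times> int"

datatype move = Go_Left | Stay | Go_Right

fun offset :: "move \<Rightarrow> int" where
  "offset Go_Left = -1"
| "offset Stay = 0"
| "offset Go_Right = 1"

fun scanned :: "tape \<Rightarrow> nat" where
  "scanned (c, h) = c h"

fun act :: "nat \<times> move \<Rightarrow> tape \<Rightarrow> tape" where
  "act (a, m) (c, h) = (c(h := a), h + offset m)"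

text \<open>
  An instruction maps the symbols under the heads to the next state and, for each tape, the symbol
  to write and the head movement. The instruction at index \<open>q\<close> of a machine's list is its transition
  function in state \<open>q\<close>; state 0 is initial, and the indices \<open>length instrs\<close> and
  \<open>length instrs + 1\<close> serve as the halting states for acceptance and rejection.
\<close>

type_synonym instr = "nat list \<Rightarrow> nat \<times> (nat \<times> move) list"

record tm =
  tape_count :: nat
  symbol_count :: nat
  instrs :: "instr list"

definition accepting_state :: "tm \<Rightarrow> nat" where
  "accepting_state M = length (instrs M)"

definition rejecting_state :: "tm \<Rightarrow> nat" where
  "rejecting_state M = length (instrs M) + 1"

text \<open>
  Well-formedness confines every instruction to a fixed finite alphabet and a fixed number of tapes,
  so that a machine is a finite object. The alphabet contains at least the blank and the three
  input symbols.
\<close>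

definition well_formed_tm :: "tm \<Rightarrow> bool" where
  "well_formed_tm M \<longleftrightarrow>
     1 \<le> tape_count M \<and> 4 \<le> symbol_count M \<and>
     (\<forall>f \<in> set (instrs M). \<forall>as. length as = tape_count M \<and> set as \<subseteq> {..<symbol_count M} \<longrightarrow>
        (case f as of (q, acts) \<Rightarrow>
           q \<le> rejecting_state M \<and> length acts = tape_count M \<and>
           fst ` set acts \<subseteq> {..<symbol_count M}))"

type_synonym config = "nat \<times> tape list"

fun tm_step :: "tm \<Rightarrow> config \<Rightarrow> config" where
  "tm_step M (q, ts) =
     (if q < length (instrs M)
      then (case (instrs M ! q) (map scanned ts) of (q', acts) \<Rightarrow> (q', map2 act acts ts))
      else (q, ts))"

definition blank_tape :: tape where
  "blank_tape = ((\<lambda>_. 0), 0)"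

definition input_tape :: "nat list \<Rightarrow> tape" where
  "input_tape w = ((\<lambda>i. if 0 \<le> i \<and> nat i < length w then w ! nat i else 0), 0)"

definition start_config :: "tm \<Rightarrow> nat list \<Rightarrow> config" where
  "start_config M w = (0, input_tape w # replicate (tape_count M - 1) blank_tape)"

text \<open>
  Halting configurations are fixed points of \<^const>\<open>tm_step\<close>, so being in a halting state after
  \<open>t\<close> steps means having halted within \<open>t\<close> steps.
\<close>

definition decides_within :: "tm \<Rightarrow> nat list \<Rightarrow> bool \<Rightarrow> real \<Rightarrow> bool" where
  "decides_within M w b T \<longleftrightarrow>
     (\<exists>t. real t \<le> T \<and>
        fst ((tm_step M ^^ t) (start_config M w)) =
          (if b then accepting_state M else rejecting_state M))"

section \<open>Input encoding\<close>

text \<open>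
  Binary expansion, most significant bit first; the symbols 1 and 2 stand for the bits 0 and 1, and
  the symbol 3 separates the components of a triple.
\<close>

fun binary :: "nat \<Rightarrow> nat list" where
  "binary n = (if n = 0 then [] else binary (n div 2) @ [if odd n then 2 else 1])"

declare binary.simps [simp del]

definition encode_triple :: "nat \<Rightarrow> nat \<Rightarrow> nat \<Rightarrow> nat list" where
  "encode_triple n u v = binary n @ [3] @ binary u @ [3] @ binary v"

end

theory Submission
  imports Defs
begin

unbundle bit_operations_syntax

text \<open>
  Let \<open>n\<close> have \<open>m + 4\<close> binary digits and let \<open>X = 2 ^ m\<close>. Split a vertex into its four leading
  bits and an \<open>m\<close>-bit label. The labels of the blocks \<open>A = {0..<X}\<close> and \<open>B = {X..<2 * X}\<close> run through
  the vector space of dimension \<open>m\<close> over \<open>GF(2)\<close>; the remaining vertices form the block \<open>C\<close>. A vertex of \<open>A\<close> is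
  joined to any other vertex according to the inner product of the labels, two vertices of \<open>B\<close>
  according to an affine version of the adjacency form of a path on the coordinates, \<open>C\<close> is
  independent, and between \<open>B\<close> and \<open>C\<close> nearly all edges are present.

  The degrees separate the three blocks by at least \<open>X\<close>, so a permutation with few violated
  pairs respects them up to few exceptions. Since distinct rows of the inner product disagree in
  half of the entries, its action on \<open>A\<close> and on \<open>B\<close> agrees with a linear map outside few points: the
  image of a label is determined by its inner products with most labels of the other block. As an
  affine function that vanishes on more than half of the space is zero, these linear maps preserve
  the inner product and the path form exactly. The path form singles out the first coordinate
  functional, and from there one coordinate after the other is seen to be fixed. Hence
  almost all of \<open>A \<union> B\<close> is fixed pointwise, and as any two vertices of the same block have
  neighbourhoods in \<open>A \<union> B\<close> that differ in \<open>\<Omega>(n)\<close> places, every moved vertex violates \<open>\<Omega>(n)\<close> pairs.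

  Adjacency is computed by a finite automaton that reads the bits of \<open>u\<close> and \<open>v\<close> in parallel from
  the least significant end, for as many steps as \<open>n\<close> has digits.
\<close>

section \<open>Two forms on bit vectors\<close>

text \<open>
  The convention that both vectors have an extra bit 1 below bit 0 makes the form \<open>pathp\<close> affine in each
  argument instead of bilinear; its additional terms are the two lowest bits.
\<close>

fun prev_bit :: "nat \<Rightarrow> nat \<Rightarrow> bool" where
  "prev_bit 0 x = True"
| "prev_bit (Suc i) x = bit x i"

primrec dotp :: "nat \<Rightarrow> nat \<Rightarrow> nat \<Rightarrow> bool" where
  "dotp 0 x y = False"
| "dotp (Suc i) x y = (dotp i x y \<noteq> (bit x i \<and> bit y i))"

primrec pathp :: "nat \<Rightarrow> nat \<Rightarrow> nat \<Rightarrow> bool" where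
  "pathp 0 x y = False"
| "pathp (Suc i) x y =
     (pathp i x y \<noteq> ((bit x i \<and> prev_bit i y) \<noteq> (bit y i \<and> prev_bit i x)))"

lemma xor_less_power: "x < 2 ^ m \<Longrightarrow> y < 2 ^ m \<Longrightarrow> x XOR y < 2 ^ m" for x y :: nat
  by (metis take_bit_nat_eq_self_iff take_bit_xor)

lemma xor_xor_cancel [simp]: "(x XOR y) XOR y = x" for x y :: nat
  by (rule bit_eqI) (auto simp: bit_xor_iff)

lemma xor_eq_0_imp_eq: "x XOR y = 0 \<Longrightarrow> x = y" for x y :: nat
  using xor_xor_cancel[of x y] by (metis xor.left_neutral)

lemma bit_imp_less: "x < 2 ^ m \<Longrightarrow> bit x i \<Longrightarrow> i < m" for x :: nat
  by (metis bit_take_bit_iff take_bit_nat_eq_self_iff)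

lemma eqI_below: "x < 2 ^ m \<Longrightarrow> y < 2 ^ m \<Longrightarrow> (\<And>i. i < m \<Longrightarrow> bit x i = bit y i) \<Longrightarrow> x = y"
  for x y :: nat
  by (rule bit_eqI) (metis bit_imp_less)

lemma prev_bit_xor: "prev_bit i (x XOR y XOR z) = (prev_bit i x \<noteq> (prev_bit i y \<noteq> prev_bit i z))"
  by (cases i) (auto simp: bit_xor_iff)

lemma dotp_commute: "dotp m x y = dotp m y x"
  by (induction m) auto

lemma dotp_xor: "dotp m (x XOR y) w = (dotp m x w \<noteq> dotp m y w)"
  by (induction m) (auto simp: bit_xor_iff)

lemma dotp_xor_right: "dotp m w (x XOR y) = (dotp m w x \<noteq> dotp m w y)"
  by (metis dotp_commute dotp_xor)

lemma dotp_0 [simp]: "\<not> dotp m 0 x" "\<not> dotp m x 0"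
  by (induction m) auto

lemma dotp_exp: "dotp m x (2 ^ i) \<longleftrightarrow> i < m \<and> bit x i"
  by (induction m) (auto simp: bit_exp_iff less_Suc_eq)

lemma dotp_eqI:
  assumes "x < 2 ^ m" "y < 2 ^ m" "\<And>w. w < 2 ^ m \<Longrightarrow> dotp m x w = dotp m y w"
  shows "x = y"
proof (rule eqI_below[OF assms(1,2)])
  fix i assume "i < m"
  with assms(3)[of "2 ^ i"] show "bit x i = bit y i"
    by (simp add: dotp_exp)
qed

lemma dotp_take_bit: "dotp m (take_bit m x) y = dotp m x y"
proof -
  have "k \<le> m \<Longrightarrow> dotp k (take_bit m x) y = dotp k x y" for k
    by (induction k) (auto simp: bit_take_bit_iff)
  then show ?thesis by simp
qed

lemma pathp_commute: "pathp m x y = pathp m y x"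
  by (induction m) auto

lemma prev_bit_take_bit: "k \<le> m \<Longrightarrow> prev_bit k (take_bit m x) = prev_bit k x"
  by (cases k) (auto simp: bit_take_bit_iff)

lemma pathp_take_bit: "pathp m (take_bit m x) y = pathp m x y"
proof -
  have "k \<le> m \<Longrightarrow> pathp k (take_bit m x) y = pathp k x y" for k
    by (induction k) (auto simp: bit_take_bit_iff prev_bit_take_bit)
  then show ?thesis by simp
qed

lemma pathp_xor: "pathp m (x XOR y XOR z) w = (pathp m x w \<noteq> (pathp m y w \<noteq> pathp m z w))"
  by (induction m) (auto simp: bit_xor_iff prev_bit_xor)

text \<open>At 0 only the affine term of \<open>x\<close> survives; this is how the form singles out
  the first coordinate.\<close>

lemma pathp_0_right: "0 < m \<Longrightarrow> pathp m x 0 = bit x 0"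
proof (induction m)
  case (Suc m)
  then show ?case by (cases m) auto
qed simp

text \<open>Coordinate \<open>i\<close> has the path neighbours \<open>i - 1\<close> and
  \<open>i + 1\<close>, and \<open>bit x 0\<close> is the affine term of \<open>x\<close>. For
  \<open>i = 0\<close> the constant \<open>prev_bit 0 x\<close> is the affine term of
  \<open>p\<close>.\<close>

lemma pathp_unit:
  assumes p: "\<And>k. bit p k \<longleftrightarrow> k = i"
  shows "i < m \<Longrightarrow> pathp m x p = ((Suc i < m \<and> bit x (Suc i)) \<noteq> (prev_bit i x \<noteq> bit x 0))"
proof (induction m)
  case (Suc m)
  have low: "k \<le> i \<Longrightarrow> pathp k x p = (k > 0 \<and> bit x 0)" for k
  proof (induction k)
    case (Suc k)
    then show ?case by (cases k) (auto simp: p)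
  qed simp
  show ?case
  proof (cases "i = m")
    case True
    then show ?thesis
      using low[of m] by (cases m) (auto simp: p)
  next
    case False
    with Suc.prems have "i < m" by simp
    moreover from this have "prev_bit m p \<longleftrightarrow> Suc i = m"
      by (cases m) (auto simp: p)
    ultimately show ?thesis
      using Suc.IH by (cases "Suc i = m") (auto simp: p)
  qed
qed simp

lemma pathp_exp:
  "i < m \<Longrightarrow> pathp m x (2 ^ i) = ((Suc i < m \<and> bit x (Suc i)) \<noteq> (prev_bit i x \<noteq> bit x 0))"
  by (rule pathp_unit) (auto simp: bit_exp_iff)

section \<open>Affine functions and almost linear maps\<close>

text \<open>Translation by \<open>z\<close> exchanges the points where \<open>h\<close> holds with
  those where it fails.\<close>

lemma half_of_flip:
  fixes z :: nat
  assumes "z < 2 ^ q" and "\<And>w. w < 2 ^ q \<Longrightarrow> h (w XOR z) \<longleftrightarrow> \<not> h w"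
  shows "2 * card {w \<in> {..<2 ^ q}. h w} = 2 ^ q"
proof -
  let ?S = "{w \<in> {..<2 ^ q}. h w}" and ?N = "{w \<in> {..<2 ^ q}. \<not> h w}"
  have "bij_betw (\<lambda>w. w XOR z) ?S ?N"
    by (rule bij_betw_byWitness[where f' = "\<lambda>w. w XOR z"])
      (use assms in \<open>auto simp: xor_less_power\<close>)
  then have "card ?S = card ?N"
    by (rule bij_betw_same_card)
  moreover have "card ?S + card ?N = card (?S \<union> ?N)"
    by (rule card_Un_disjoint[symmetric]) auto
  moreover have "?S \<union> ?N = {..<2 ^ q}"
    by auto
  ultimately show ?thesis by simp
qed

text \<open>\<open>q\<close> may exceed \<open>m\<close> because degrees are counted over several
  copies of the label space.\<close>

lemma dotp_half:
  assumes "x < 2 ^ m" "x \<noteq> 0" "m \<le> q"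
  shows "2 * card {w \<in> {..<2 ^ q}. dotp m x w} = (2::nat) ^ q"
proof -
  obtain z where z: "z < 2 ^ m" "dotp m x z"
    using dotp_eqI[of x m 0] assms by auto
  have "z < 2 ^ q"
    using z(1) assms(3) by (meson less_le_trans one_le_numeral power_increasing)
  then show ?thesis
    by (rule half_of_flip) (simp add: dotp_xor_right z)
qed

lemma dotp_half_compl:
  assumes "x < 2 ^ m" "x \<noteq> 0" "m \<le> q"
  shows "2 * card {w \<in> {..<2 ^ q}. \<not> dotp m x w} = (2::nat) ^ q"
proof -
  have "{w \<in> {..<2 ^ q}. \<not> dotp m x w} = {..<2 ^ q} - {w \<in> {..<2 ^ q}. dotp m x w}"
    by auto
  then have "card {w \<in> {..<2 ^ q}. \<not> dotp m x w}
      = 2 ^ q - card {w \<in> {..<2 ^ q}. dotp m x w}"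
    by (simp only:, subst card_Diff_subset) auto
  with dotp_half[OF assms] show ?thesis by simp
qed

text \<open>Over GF(2), respecting sums of three vectors characterises affine functions, constants
  included.\<close>

definition affine_below :: "nat \<Rightarrow> (nat \<Rightarrow> bool) \<Rightarrow> bool" where
  "affine_below m h \<longleftrightarrow> (\<forall>x<2 ^ m. \<forall>y<2 ^ m. \<forall>z<2 ^ m.
     h (x XOR y XOR z) = (h x \<noteq> (h y \<noteq> h z)))"

text \<open>If \<open>h\<close> takes both values, translation by the sum of two points with
  different values flips \<open>h\<close>, so it holds on exactly half of the space.\<close>

lemma affine_below_zero:
  assumes h: "affine_below m h" and few: "2 * card {w \<in> {..<2 ^ m}. h w} < 2 ^ m" and "x < 2 ^ m"
  shows "\<not> h x"
proof
  assume "h x"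
  have "\<exists>z<2 ^ m. \<not> h z"
  proof (rule ccontr)
    assume "\<not> ?thesis"
    then have "{w \<in> {..<2 ^ m}. h w} = {..<2 ^ m}" by auto
    with few show False by simp
  qed
  then obtain z where z: "z < 2 ^ m" "\<not> h z" by blast
  have "2 * card {w \<in> {..<2 ^ m}. h w} = 2 ^ m"
    by (rule half_of_flip[of "x XOR z"])
      (use h z \<open>h x\<close> \<open>x < 2 ^ m\<close> in \<open>auto simp: affine_below_def xor_less_power\<close>)
  with few show False by simp
qed

text \<open>Rows in \<open>G\<close> vanish by the previous lemma; so each column is supported
  outside \<open>G\<close>, on less than half, and vanishes too.\<close>

lemma affine_below_zero2:
  assumes "\<And>y. y < 2 ^ m \<Longrightarrow> affine_below m (\<lambda>x. h x y)"
    and "\<And>x. x < 2 ^ m \<Longrightarrow> affine_below m (h x)"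
    and few: "2 * card {x \<in> {..<2 ^ m}. x \<notin> G} < 2 ^ m"
    and row: "\<And>x. x \<in> G \<Longrightarrow> x < 2 ^ m \<Longrightarrow> 2 * card {y \<in> {..<2 ^ m}. h x y} < 2 ^ m"
    and "x < 2 ^ m" "y < 2 ^ m"
  shows "\<not> h x y"
proof (rule affine_below_zero[of m "\<lambda>x. h x y"])
  have "\<not> h x y" if "x \<in> G" "x < 2 ^ m" for x
    using affine_below_zero[OF assms(2) row] that assms(6) by blast
  then have "card {x \<in> {..<2 ^ m}. h x y} \<le> card {x \<in> {..<2 ^ m}. x \<notin> G}"
    by (intro card_mono) auto
  with few show "2 * card {x \<in> {..<2 ^ m}. h x y} < 2 ^ m" by simp
qed (use assms in auto)

text \<open>Induction along the path. The path form against 0 gives coordinate 0. Once the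
  coordinates up to \<open>i\<close> are preserved, \<open>M (2 ^ i)\<close> and
  \<open>2 ^ i\<close> have the same inner product with every \<open>M x\<close>, so this unit
  vector is fixed; the path form against it then gives coordinate \<open>i + 1\<close>.\<close>

lemma path_rigid:
  assumes M: "\<And>x. x < 2 ^ m \<Longrightarrow> M x < 2 ^ m" "M 0 = 0"
    and dot: "\<And>x y. x < 2 ^ m \<Longrightarrow> y < 2 ^ m \<Longrightarrow> dotp m (M x) (M y) = dotp m x y"
    and path: "\<And>x y. x < 2 ^ m \<Longrightarrow> y < 2 ^ m \<Longrightarrow> pathp m (M x) (M y) = pathp m x y"
    and "x < 2 ^ m"
  shows "M x = x"
proof -
  have inj: "inj_on M {..<2 ^ m}"
    by (rule inj_onI, rule dotp_eqI[of _ m]) (auto simp flip: dot)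
  have surj: "M ` {..<2 ^ m} = {..<2 ^ m}"
    by (rule endo_inj_surj) (use M inj in auto)
  have bits: "i < m \<Longrightarrow> \<forall>j\<le>i. \<forall>x<2 ^ m. bit (M x) j = bit x j" for i
  proof (induction i)
    case 0
    then show ?case
      using path[of _ 0] M by (auto simp: pathp_0_right)
  next
    case (Suc i)
    have IH: "bit (M x) j = bit x j" if "j \<le> i" "x < 2 ^ m" for j x
      using Suc that by simp
    have "M (2 ^ i) = 2 ^ i"
    proof (rule dotp_eqI[of _ m])
      fix w :: nat assume "w < 2 ^ m"
      then obtain x where x: "x < 2 ^ m" "w = M x"
        using surj by (metis imageE lessThan_iff)
      have "dotp m (M x) (M (2 ^ i)) = dotp m (M x) (2 ^ i)"
        using dot[OF x(1), of "2 ^ i"] Suc.prems IH[of i] x(1) by (simp add: dotp_exp)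
      then show "dotp m (M (2 ^ i)) w = dotp m (2 ^ i) w"
        using x by (simp add: dotp_commute)
    qed (use M Suc.prems in auto)
    then have "pathp m (M x) (2 ^ i) = pathp m x (2 ^ i)" if "x < 2 ^ m" for x
      using path[OF that, of "2 ^ i"] Suc.prems by simp
    moreover have "prev_bit i (M x) = prev_bit i x" if "x < 2 ^ m" for x
      using IH[OF _ that] by (cases i) auto
    ultimately have "bit (M x) (Suc i) = bit x (Suc i)" if "x < 2 ^ m" for x
      using that Suc.prems IH[of 0] by (auto simp: pathp_exp)
    with IH show ?case by (auto simp: le_Suc_eq)
  qed
  show ?thesis
    by (rule eqI_below[of _ m]) (use M \<open>x < 2 ^ m\<close> bits in auto)
qed

text \<open>\<open>\<sigma>\<close> acts on the rows and \<open>\<tau>\<close> on the columns of the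
  inner product. Every \<open>x\<close> is a sum of two elements of \<open>G\<close>, and its image
  is determined by the inner products with most \<open>\<tau> b\<close>.\<close>

lemma linear_extension:
  fixes \<sigma> \<tau> :: "nat \<Rightarrow> nat"
  assumes inj: "inj_on \<tau> T" and \<tau>: "\<And>b. b \<in> T \<Longrightarrow> \<tau> b < 2 ^ m"
    and few: "2 * card {x \<in> {..<2 ^ m}. x \<notin> G} < 2 ^ m"
    and \<sigma>: "\<And>a. a \<in> G \<Longrightarrow> a < 2 ^ m \<Longrightarrow> \<sigma> a < 2 ^ m"
    and err: "\<And>a. a \<in> G \<Longrightarrow> a < 2 ^ m \<Longrightarrow>
      16 * card {b \<in> {..<2 ^ m}. \<not> (b \<in> T \<and> dotp m (\<sigma> a) (\<tau> b) = dotp m a b)} \<le> 2 ^ m"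
  obtains L where "\<And>x. x < 2 ^ m \<Longrightarrow> L x < 2 ^ m"
    and "\<And>x y. x < 2 ^ m \<Longrightarrow> y < 2 ^ m \<Longrightarrow> L (x XOR y) = L x XOR L y"
    and "\<And>a. a \<in> G \<Longrightarrow> a < 2 ^ m \<Longrightarrow> L a = \<sigma> a"
proof -
  define Err where
    "Err x z = {b \<in> {..<2 ^ m}. \<not> (b \<in> T \<and> dotp m z (\<tau> b) = dotp m x b)}" for x z
  have fin: "finite (Err x z)" for x z
    by (simp add: Err_def)
  have xor: "card (Err (x XOR x') (z XOR z')) \<le> card (Err x z) + card (Err x' z')" for x x' z z'
  proof -
    have "Err (x XOR x') (z XOR z') \<subseteq> Err x z \<union> Err x' z'"
      by (auto simp: Err_def dotp_xor)
    then have "card (Err (x XOR x') (z XOR z')) \<le> card (Err x z \<union> Err x' z')"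
      by (rule card_mono[rotated]) (simp add: fin)
    also have "\<dots> \<le> card (Err x z) + card (Err x' z')"
      by (rule card_Un_le)
    finally show ?thesis .
  qed
  \<comment> \<open>Outside both error sets \<open>z XOR z'\<close> is orthogonal to
    \<open>\<tau> b\<close>. For \<open>z \<noteq> z'\<close> this holds for at most half of the
    labels, as \<open>\<tau>\<close> is injective.\<close>
  have unique: "z = z'"
    if z: "z < 2 ^ m" "z' < 2 ^ m" and small: "2 * (card (Err x z) + card (Err x z')) < 2 ^ m" for x z z'
  proof (rule ccontr)
    assume "z \<noteq> z'"
    then have w: "z XOR z' < 2 ^ m" "z XOR z' \<noteq> 0"
      using z xor_eq_0_imp_eq by (auto simp: xor_less_power)
    let ?Z = "{b \<in> T. \<not> dotp m (z XOR z') (\<tau> b)}" and ?N = "{c \<in> {..<2 ^ m}. \<not> dotp m (z XOR z') c}"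
    have "\<tau> ` ?Z \<subseteq> ?N" using \<tau> by auto
    then have "card ?Z \<le> card ?N"
      by (rule card_inj_on_le[rotated]) (use inj in \<open>auto simp: inj_on_def\<close>)
    moreover have finZ: "finite ?Z"
      by (rule finite_imageD[of \<tau>], rule finite_subset[OF \<open>\<tau> ` ?Z \<subseteq> ?N\<close>])
        (use inj in \<open>auto simp: inj_on_def\<close>)
    moreover have "2 * card ?N = 2 ^ m"
      using dotp_half_compl[OF w, of m] by simp
    moreover have "2 ^ m \<le> card (Err x z) + card (Err x z') + card ?Z"
    proof -
      have "{..<2 ^ m} \<subseteq> Err x z \<union> Err x z' \<union> ?Z"
        by (auto simp: Err_def dotp_xor)
      then have "card {..<(2::nat) ^ m} \<le> card (Err x z \<union> Err x z' \<union> ?Z)"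
        by (rule card_mono[rotated]) (use fin finZ in auto)
      also have "\<dots> \<le> card (Err x z) + card (Err x z') + card ?Z"
        by (meson card_Un_le add_right_mono order_trans)
      finally show ?thesis by simp
    qed
    moreover have False if "c \<le> d" "2 * d = P" "P \<le> a + b + c" "2 * (a + b) < P"
      for a b c d P :: nat
      using that by simp
    ultimately show False using small by blast
  qed
  have ex: "\<exists>z<2 ^ m. 8 * card (Err x z) \<le> 2 ^ m" if x: "x < 2 ^ m" for x
  proof -
    \<comment> \<open>\<open>G\<close> and its translate by \<open>x\<close> each miss less than
      half of the space, so they meet.\<close>
    have "\<exists>a<2 ^ m. a \<in> G \<and> a XOR x \<in> G"
    proof (rule ccontr)
      assume none: "\<not> ?thesis"
      let ?H = "{a \<in> {..<2 ^ m}. a \<notin> G}" and ?H' = "{a \<in> {..<2 ^ m}. a XOR x \<notin> G}"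
      have "bij_betw (\<lambda>a. a XOR x) ?H' ?H"
        by (rule bij_betw_byWitness[where f' = "\<lambda>a. a XOR x"]) (use x in \<open>auto simp: xor_less_power\<close>)
      then have "card ?H' = card ?H" by (rule bij_betw_same_card)
      moreover have "{..<2 ^ m} \<subseteq> ?H \<union> ?H'" using none by auto
      then have "card {..<(2::nat) ^ m} \<le> card (?H \<union> ?H')"
        by (rule card_mono[rotated]) auto
      moreover have "card (?H \<union> ?H') \<le> card ?H + card ?H'"
        by (rule card_Un_le)
      ultimately show False using few by simp
    qed
    then obtain a where a: "a < 2 ^ m" "a \<in> G" "a XOR x \<in> G" by blast
    have "16 * card (Err a (\<sigma> a)) \<le> 2 ^ m" "16 * card (Err (a XOR x) (\<sigma> (a XOR x))) \<le> 2 ^ m"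
      using err a x by (auto simp: Err_def xor_less_power)
    moreover have "a XOR (a XOR x) = x"
      by (rule bit_eqI) (auto simp: bit_xor_iff)
    ultimately have "8 * card (Err x (\<sigma> a XOR \<sigma> (a XOR x))) \<le> 2 ^ m"
      using xor[of a "a XOR x" "\<sigma> a" "\<sigma> (a XOR x)"] by simp
    with \<sigma> a x show ?thesis
      by (intro exI[of _ "\<sigma> a XOR \<sigma> (a XOR x)"]) (simp add: xor_less_power)
  qed
  then obtain L where L: "\<And>x. x < 2 ^ m \<Longrightarrow> L x < 2 ^ m"
    "\<And>x. x < 2 ^ m \<Longrightarrow> 8 * card (Err x (L x)) \<le> 2 ^ m"
    by metis
  show ?thesis
  proof (rule that[of L])
    fix x y :: nat assume xy: "x < 2 ^ m" "y < 2 ^ m"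
    show "L (x XOR y) = L x XOR L y"
    proof (rule unique[of _ _ "x XOR y"])
      \<comment> \<open>The error is at most 1/8 for the chosen image and 1/8 + 1/8 for the sum of
        images; the total 3/8 is below the 1/2 that \<open>unique\<close> allows.\<close>
      have "2 * (d + e) < P" if "0 < P" "e \<le> a + b" "8 * a \<le> P" "8 * b \<le> P" "8 * d \<le> P"
        for a b d e P :: nat
        using that by simp
      from this[OF _ xor L(2)[OF xy(1)] L(2)[OF xy(2)] L(2)[OF xor_less_power[OF xy]]]
      show "2 * (card (Err (x XOR y) (L (x XOR y))) + card (Err (x XOR y) (L x XOR L y))) < 2 ^ m"
        by simp
    qed (use L xy in \<open>auto simp: xor_less_power\<close>)
  next
    fix a assume a: "a \<in> G" "a < 2 ^ m"
    show "L a = \<sigma> a"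
    proof (rule unique[of _ _ a])
      have "2 * (d + e) < P" if "0 < P" "8 * d \<le> P" "16 * e \<le> P" for d e P :: nat
        using that by simp
      from this[OF _ L(2)[OF a(2)] err[OF a, folded Err_def]]
      show "2 * (card (Err a (L a)) + card (Err a (\<sigma> a))) < 2 ^ m"
        by simp
    qed (use L \<sigma> a in auto)
  qed (use L in auto)
qed

text \<open>\<open>L\<close> stands for the action on A and \<open>M\<close> for that on B.
  \<open>LL\<close> makes \<open>L\<close> onto, so \<open>LL\<close> and \<open>LM\<close> force
  \<open>M = L\<close>; then \<open>M\<close> preserves both forms.\<close>

lemma path_rigid_pair:
  assumes L: "\<And>x. x < 2 ^ m \<Longrightarrow> L x < 2 ^ m" and M: "\<And>x. x < 2 ^ m \<Longrightarrow> M x < 2 ^ m" "M 0 = 0"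
    and LL: "\<And>x y. x < 2 ^ m \<Longrightarrow> y < 2 ^ m \<Longrightarrow> dotp m (L x) (L y) = dotp m x y"
    and LM: "\<And>x y. x < 2 ^ m \<Longrightarrow> y < 2 ^ m \<Longrightarrow> dotp m (L x) (M y) = dotp m x y"
    and path: "\<And>x y. x < 2 ^ m \<Longrightarrow> y < 2 ^ m \<Longrightarrow> pathp m (M x) (M y) = pathp m x y"
    and "x < 2 ^ m"
  shows "L x = x" "M x = x"
proof -
  have "inj_on L {..<2 ^ m}"
    by (rule inj_onI, rule dotp_eqI[of _ m]) (auto simp flip: LL)
  then have surj: "L ` {..<2 ^ m} = {..<2 ^ m}"
    by (intro endo_inj_surj) (use L in auto)
  have eq: "M y = L y" if y: "y < 2 ^ m" for y
  proof (rule dotp_eqI[of _ m])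
    fix w :: nat assume "w < 2 ^ m"
    then obtain x where "x < 2 ^ m" "w = L x"
      using surj by (metis imageE lessThan_iff)
    then show "dotp m (M y) w = dotp m (L y) w"
      using LL LM y by (simp add: dotp_commute)
  qed (use L M y in auto)
  show "M x = x"
    by (rule path_rigid[of m]) (use assms eq in auto)
  with eq \<open>x < 2 ^ m\<close> show "L x = x" by simp
qed

section \<open>Rigidity of the graph\<close>

text \<open>The bounds on \<open>n\<close> say that it has \<open>m + 4\<close> binary digits.
  \<open>Y\<close> is the number of labels with given four leading bits and the unit of all error
  bounds.\<close>

locale code_graph =
  fixes m n X Y :: nat
  assumes X: "X = 2 ^ m" and XY: "X = 16 * Y" and Y_pos: "0 < Y"
    and n_lower: "8 * X \<le> n" and n_upper: "n < 16 * X"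
begin

lemma X_pos: "0 < X"
  using XY Y_pos by simp

text \<open>
  \<open>B\<close> and \<open>C\<close> cannot be joined completely: the blocks \<open>u div X\<close> inside \<open>C\<close> are told apart by
  the vertices of \<open>B\<close> whose four leading label bits spell \<open>u div X\<close>.
\<close>

definition adj :: "nat \<Rightarrow> nat \<Rightarrow> bool" where
  "adj u v =
    (if u div X = 1 \<and> v div X = 1 then pathp m u v
     else if u div X = 0 \<or> v div X = 0 then dotp m u v
     else if u div X = 1 then u mod X div Y \<noteq> v div X
     else if v div X = 1 then v mod X div Y \<noteq> u div X
     else False)"

lemma adj_commute: "adj u v = adj v u"
  by (auto simp: adj_def dotp_commute pathp_commute)

definition block :: "nat \<Rightarrow> nat" where
  "block u = (if u < X then 0 else if u < 2 * X then 1 else 2)"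

lemma adj_low: "u < X \<Longrightarrow> adj u v = dotp m u v"
  by (auto simp: adj_def)

lemma div_X_eq_1_iff: "u div X = Suc 0 \<longleftrightarrow> X \<le> u \<and> u < 2 * X"
proof -
  have "u div X = Suc 0 \<longleftrightarrow> 1 \<le> u div X \<and> u div X < 2" by auto
  then show ?thesis
    using X_pos by (simp only: less_eq_div_iff_mult_less_eq div_less_iff_less_mult) simp
qed

lemma dotp_mod_right: "dotp m u (v mod X) = dotp m u v"
  using dotp_take_bit[of m v u] by (simp add: X take_bit_eq_mod dotp_commute)

lemma dotp_add_right: "dotp m u (X + v) = dotp m u v"
  using dotp_mod_right[of u "X + v"] dotp_mod_right[of u v] by simp

lemma pathp_mod_right: "pathp m u (v mod X) = pathp m u v"
  using pathp_take_bit[of m v u] by (simp add: X take_bit_eq_mod pathp_commute)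

lemma pathp_add_right: "pathp m u (X + v) = pathp m u v"
  using pathp_mod_right[of u "X + v"] pathp_mod_right[of u v] by simp

lemma adj_mid: "u < X \<Longrightarrow> v < X \<Longrightarrow> adj (X + u) (X + v) = pathp m u v"
  using X_pos by (simp add: adj_def pathp_add_right pathp_commute[of m "X + u"] pathp_commute[of m v u])

lemma adj_shift:
  assumes "s \<in> {0, X}" "t \<in> {0, X}" "s = 0 \<or> t = 0" "x < X" "y < X"
  shows "adj (s + x) (t + y) = dotp m x y"
  using assms by (auto simp: adj_low dotp_add_right adj_commute[of "X + x"] dotp_commute)

section \<open>Degrees and distances between neighbourhoods\<close>

definition deg :: "nat \<Rightarrow> nat" where
  "deg u = card {w \<in> {..n}. adj u w}"

text \<open>The numbers below \<open>8 * X\<close> form eight full copies of the label space;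
  \<open>u\<close> is adjacent to exactly half of them.\<close>

lemma deg_low:
  assumes "u < X" "u \<noteq> 0"
  shows "4 * X \<le> deg u" "deg u + 4 * X \<le> n + 1"
proof -
  have q: "8 * X = 2 ^ (m + 3)" by (simp add: X power_add)
  have half: "2 * card {w \<in> {..<8 * X}. dotp m u w} = 8 * X"
    "2 * card {w \<in> {..<8 * X}. \<not> dotp m u w} = 8 * X"
    unfolding q by (rule dotp_half dotp_half_compl; use assms X in simp)+
  have "card {w \<in> {..<8 * X}. dotp m u w} \<le> deg u"
    unfolding deg_def by (rule card_mono) (use assms n_lower in \<open>auto simp: adj_low\<close>)
  with half show "4 * X \<le> deg u" by simp
  have "deg u + card {w \<in> {..<8 * X}. \<not> dotp m u w} =
      card ({w \<in> {..n}. adj u w} \<union> {w \<in> {..<8 * X}. \<not> dotp m u w})"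
    unfolding deg_def by (rule card_Un_disjoint[symmetric]) (use assms in \<open>auto simp: adj_low\<close>)
  also have "\<dots> \<le> card {..n}"
    by (rule card_mono) (use n_lower in auto)
  finally show "deg u + 4 * X \<le> n + 1" using half by simp
qed

text \<open>A vertex of B can miss only A, B and at most one further block of size
  \<open>X\<close>.\<close>

lemma deg_mid:
  assumes "X \<le> u" "u < 2 * X"
  shows "n + 1 \<le> deg u + 3 * X"
proof -
  define p where "p = u mod X div Y"
  have "adj u w" if "2 * X \<le> w" "w div X \<noteq> p" for w
  proof -
    have "2 \<le> w div X" using that X_pos by (simp add: less_eq_div_iff_mult_less_eq mult.commute)
    moreover have "u div X = 1" using assms by (simp add: div_X_eq_1_iff)
    ultimately show ?thesis using that by (simp add: adj_def p_def)
  qed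
  then have "{..n} \<subseteq> {w \<in> {..n}. adj u w} \<union> {..<2 * X} \<union> {p * X..<p * X + X}"
    using X_pos by (auto simp: not_le div_nat_eqI) (metis div_mult_mod_eq le_add1 mod_less_divisor nat_add_left_cancel_less not_le)+
  then have "card {..n} \<le> card ({w \<in> {..n}. adj u w} \<union> {..<2 * X} \<union> {p * X..<p * X + X})"
    by (rule card_mono[rotated]) auto
  also have "\<dots> \<le> deg u + 2 * X + X"
    unfolding deg_def by (intro order_trans[OF card_Un_le] add_mono) auto
  finally show ?thesis by simp
qed

lemma deg_high:
  assumes "2 * X \<le> u"
  shows "deg u \<le> 2 * X"
proof -
  have "2 \<le> u div X" using assms X_pos by (simp add: less_eq_div_iff_mult_less_eq mult.commute)
  then have "w < 2 * X" if "adj u w" for w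
    using that X_pos assms by (auto simp: adj_def div_X_eq_1_iff div_eq_0_iff split: if_splits)
  then have "{w \<in> {..n}. adj u w} \<subseteq> {..<2 * X}" by auto
  then show ?thesis unfolding deg_def
    by (metis card_lessThan card_mono finite_lessThan)
qed

lemma deg_gap:
  assumes "u \<noteq> 0" "v \<noteq> 0" "block u \<noteq> block v"
  shows "deg u + X \<le> deg v \<or> deg v + X \<le> deg u"
  using assms deg_low[of u] deg_low[of v] deg_mid[of u] deg_mid[of v] deg_high[of u] deg_high[of v] n_lower
  by (auto simp: block_def not_less split: if_splits)

text \<open>Vertices with different labels disagree on half of A. Distinct vertices with equal
  labels and the same \<open>block\<close> lie in C and have different values of
  \<open>div X\<close>; the \<open>Y\<close> vertices of B that spell \<open>u div X\<close> are
  joined to \<open>v\<close> but not to \<open>u\<close>.\<close>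

lemma row_distance:
  assumes uv: "u \<le> n" "v \<le> n" "u \<noteq> v" "block u = block v"
  shows "Y \<le> card {w \<in> {..<2 * X}. adj u w \<noteq> adj v w}"
proof (cases "u mod X = v mod X")
  case False
  define z where "z = (u mod X) XOR (v mod X)"
  have z: "z < 2 ^ m" "z \<noteq> 0"
    using False X_pos xor_eq_0_imp_eq by (auto simp: z_def X intro!: xor_less_power)
  have "adj u w \<noteq> adj v w" if "w < X" "dotp m z w" for w
    using that adj_low[of w u] adj_low[of w v] adj_commute[of w]
      dotp_xor_right[of m w "u mod X" "v mod X"] dotp_commute[of m z w]
    by (simp add: dotp_mod_right flip: z_def)
  then have "{w \<in> {..<2 ^ m}. dotp m z w} \<subseteq> {w \<in> {..<2 * X}. adj u w \<noteq> adj v w}"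
    by (auto simp: X)
  then have "card {w \<in> {..<2 ^ m}. dotp m z w} \<le> card {w \<in> {..<2 * X}. adj u w \<noteq> adj v w}"
    by (rule card_mono[rotated]) auto
  with dotp_half[OF z, of m] XY X show ?thesis by simp
next
  case True
  then have neq: "u div X \<noteq> v div X"
    using uv by (metis div_mult_mod_eq)
  have "w div X = block w" if "w < 2 * X" for w
    using that X_pos by (auto simp: block_def div_X_eq_1_iff)
  moreover have "w < 2 * X \<longleftrightarrow> block w \<noteq> 2" for w
    by (simp add: block_def)
  ultimately have "\<not> u < 2 * X" "\<not> v < 2 * X"
    using uv neq by metis+
  then have ge: "2 \<le> u div X" "2 \<le> v div X"
    using X_pos by (simp_all add: less_eq_div_iff_mult_less_eq mult.commute)
  have lt: "u div X < 16"
    using uv n_upper by (simp add: less_mult_imp_div_less)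
  let ?f = "\<lambda>j. X + (u div X * Y + j)"
  have "adj u (?f j) \<noteq> adj v (?f j)" "?f j < 2 * X" if "j < Y" for j
  proof -
    have le: "u div X * Y + j < X"
    proof -
      have "u div X * Y \<le> 15 * Y" using lt by simp
      with that have "u div X * Y + j < 15 * Y + Y" by (rule add_le_less_mono[rotated])
      with XY show ?thesis by simp
    qed
    then show "?f j < 2 * X" by simp
    have "?f j div X = 1" using le X_pos by simp
    moreover have "?f j mod X div Y = u div X"
      using le that by (simp add: mod_less)
    ultimately show "adj u (?f j) \<noteq> adj v (?f j)"
      using ge neq by (simp add: adj_def)
  qed
  then have "?f ` {..<Y} \<subseteq> {w \<in> {..<2 * X}. adj u w \<noteq> adj v w}" by auto
  then have "card (?f ` {..<Y}) \<le> card {w \<in> {..<2 * X}. adj u w \<noteq> adj v w}"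
    by (rule card_mono[rotated]) auto
  moreover have "card (?f ` {..<Y}) = Y"
    by (subst card_image) (auto simp: inj_on_def)
  ultimately show ?thesis by simp
qed

end

section \<open>Permutations that violate few pairs\<close>

locale code_graph_permutation = code_graph +
  fixes \<pi> :: "nat \<Rightarrow> nat"
  assumes \<pi>: "\<pi> permutes {1..n}"
begin

text \<open>
  Vertex 0 is not in the graph. It is isolated and fixed, so including it changes nothing and makes
  \<open>A\<close> a full vector space.
\<close>

definition mismatches :: "nat \<Rightarrow> nat set" where
  "mismatches v = {w \<in> {..n}. adj v w \<noteq> adj (\<pi> v) (\<pi> w)}"

text \<open>The threshold \<open>Y / 2\<close> together with at most \<open>Y / 8\<close> bad
  vertices leaves fewer than \<open>Y\<close> errors in a row. \<open>Y\<close> is both the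
  sixteenth of the labels that \<open>linear_extension\<close> tolerates and the bound of
  \<open>row_distance\<close>.\<close>

abbreviation good :: "nat set" where
  "good \<equiv> {v \<in> {..n}. 2 * card (mismatches v) < Y}"

lemma finite_mismatches [simp]: "finite (mismatches v)"
  by (simp add: mismatches_def)

lemma \<pi>_0: "\<pi> 0 = 0"
  using \<pi> by (simp add: permutes_not_in)

lemma \<pi>_V: "\<pi> permutes {..n}"
  using \<pi> by (rule permutes_subset) auto

lemma \<pi>_eq_iff: "\<pi> v = \<pi> w \<longleftrightarrow> v = w"
  using permutes_inj[OF \<pi>] by (auto dest: injD)

lemma \<pi>_eq_0_iff: "\<pi> v = 0 \<longleftrightarrow> v = 0"
  using \<pi>_eq_iff[of v 0] by (simp add: \<pi>_0)

lemma \<pi>_le: "v \<le> n \<Longrightarrow> \<pi> v \<le> n"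
  using permutes_in_image[OF \<pi>_V, of v] by simp

lemma deg_image: "deg (\<pi> v) = card {w \<in> {..n}. adj (\<pi> v) (\<pi> w)}"
proof -
  have "bij_betw \<pi> {w \<in> {..n}. adj (\<pi> v) (\<pi> w)} {w \<in> {..n}. adj (\<pi> v) w}"
  proof (rule bij_betw_imageI)
    show "inj_on \<pi> {w \<in> {..n}. adj (\<pi> v) (\<pi> w)}"
      by (simp add: inj_on_def \<pi>_eq_iff)
    show "\<pi> ` {w \<in> {..n}. adj (\<pi> v) (\<pi> w)} = {w \<in> {..n}. adj (\<pi> v) w}"
      using permutes_image[OF \<pi>_V] by (auto 0 4 simp: \<pi>_le)
  qed
  then show ?thesis
    unfolding deg_def by (rule bij_betw_same_card[symmetric])
qed

lemma deg_image_bounds: "deg v \<le> deg (\<pi> v) + card (mismatches v)" "deg (\<pi> v) \<le> deg v + card (mismatches v)"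
proof -
  let ?S = "{w \<in> {..n}. adj v w}" and ?T = "{w \<in> {..n}. adj (\<pi> v) (\<pi> w)}"
  have "card ?S \<le> card (?T \<union> mismatches v)" "card ?T \<le> card (?S \<union> mismatches v)"
    by (rule card_mono, simp, force simp: mismatches_def)+
  moreover have "card (?T \<union> mismatches v) \<le> card ?T + card (mismatches v)" "card (?S \<union> mismatches v) \<le> card ?S + card (mismatches v)"
    by (rule card_Un_le)+
  ultimately show "deg v \<le> deg (\<pi> v) + card (mismatches v)" "deg (\<pi> v) \<le> deg v + card (mismatches v)"
    by (auto simp: deg_image) (auto simp: deg_def)
qed

lemma good_same_block:
  assumes "v \<in> good"
  shows "block (\<pi> v) = block v"
proof (rule ccontr)
  assume ne: "block (\<pi> v) \<noteq> block v"
  then have "v \<noteq> 0" using \<pi>_0 by metis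
  with ne have "X \<le> card (mismatches v)"
    using deg_gap[of v "\<pi> v"] deg_image_bounds[of v] by (auto simp: \<pi>_eq_0_iff)
  with assms XY show False by simp
qed

lemma good_low: "v \<in> good \<Longrightarrow> v < X \<Longrightarrow> \<pi> v < X"
  using good_same_block[of v] by (auto simp: block_def split: if_splits)

lemma good_mid: "v \<in> good \<Longrightarrow> X \<le> v \<Longrightarrow> v < 2 * X \<Longrightarrow> X \<le> \<pi> v \<and> \<pi> v < 2 * X"
  using good_same_block[of v] by (auto simp: block_def split: if_splits)

lemma good_shift:
  assumes "s \<in> {0, X}" "x < X" "s + x \<in> good"
  shows "\<pi> (s + x) - s < X" "s + (\<pi> (s + x) - s) = \<pi> (s + x)"
  using good_low[of x] good_mid[of "X + x"] assms by auto

lemma shift_le: "s \<in> {0, X} \<Longrightarrow> x < X \<Longrightarrow> s + x \<le> n"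
  using n_lower by auto

lemma card_shift_le:
  assumes "finite S" and "\<And>x. x < X \<Longrightarrow> P x \<Longrightarrow> s + x \<in> S"
  shows "card {x \<in> {..<X}. P x} \<le> card S"
  by (rule card_inj_on_le[of "\<lambda>x. s + x"]) (use assms in auto)

section \<open>Few bad vertices: every good vertex is fixed\<close>

context
  assumes few_bad: "8 * card ({..n} - good) \<le> Y"
begin

lemma close_row:
  assumes v: "v \<in> good" and t: "t \<in> {0, X}"
    and P: "\<And>y. y < X \<Longrightarrow> P y \<Longrightarrow> t + y \<in> good \<Longrightarrow> adj v (t + y) \<noteq> adj (\<pi> v) (\<pi> (t + y))"
  shows "card {y \<in> {..<X}. P y} < Y"
proof -
  have "card {y \<in> {..<X}. P y} \<le> card (({..n} - good) \<union> mismatches v)"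
    using P shift_le[OF t] by (intro card_shift_le[of _ _ t]) (auto simp: mismatches_def)
  also have "\<dots> \<le> card ({..n} - good) + card (mismatches v)"
    by (rule card_Un_le)
  also have "\<dots> < Y"
    using v few_bad by simp
  finally show ?thesis .
qed

lemma few_bad_shift:
  assumes "s \<in> {0, X}"
  shows "2 * card {x \<in> {..<X}. s + x \<notin> good} < X"
proof -
  have "card {x \<in> {..<X}. s + x \<notin> good} \<le> card ({..n} - good)"
    using shift_le[OF assms] by (intro card_shift_le[of _ _ s]) auto
  then show ?thesis
    using few_bad XY Y_pos by simp
qed

text \<open>\<open>h\<close> stands for the discrepancy between a form and its transform. It is
  affine in each argument and vanishes on good pairs without mismatch, hence everywhere by
  \<open>affine_below_zero2\<close>.\<close>

lemma preserved_extend: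
  assumes "\<And>y. y < X \<Longrightarrow> affine_below m (\<lambda>x. h x y)" "\<And>x. x < X \<Longrightarrow> affine_below m (h x)"
    and s: "s \<in> {0, X}" and t: "t \<in> {0, X}"
    and h: "\<And>x y. x < X \<Longrightarrow> y < X \<Longrightarrow> s + x \<in> good \<Longrightarrow> t + y \<in> good \<Longrightarrow>
        adj (s + x) (t + y) = adj (\<pi> (s + x)) (\<pi> (t + y)) \<Longrightarrow> \<not> h x y"
    and "x < X" "y < X"
  shows "\<not> h x y"
proof (rule affine_below_zero2[of m h "{x. s + x \<in> good}"])
  show "2 * card {x \<in> {..<2 ^ m}. x \<notin> {x. s + x \<in> good}} < 2 ^ m"
    using few_bad_shift[OF s] X by simp
  show "2 * card {y \<in> {..<2 ^ m}. h x y} < 2 ^ m" if "x \<in> {x. s + x \<in> good}" "x < 2 ^ m" for x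
  proof -
    have "card {y \<in> {..<X}. h x y} < Y"
      using h that X by (intro close_row[OF _ t]) auto
    with XY show ?thesis by (simp flip: X)
  qed
qed (use assms X in auto)

lemma linear_part:
  assumes s: "s \<in> {0, X}" and t: "t \<in> {0, X}" and st: "s = 0 \<or> t = 0"
  obtains L where "\<And>x. x < X \<Longrightarrow> L x < X"
    and "\<And>x y. x < X \<Longrightarrow> y < X \<Longrightarrow> L (x XOR y) = L x XOR L y"
    and "\<And>x. x < X \<Longrightarrow> s + x \<in> good \<Longrightarrow> s + L x = \<pi> (s + x)"
proof -
  let ?\<sigma> = "\<lambda>x. \<pi> (s + x) - s" and ?\<tau> = "\<lambda>y. \<pi> (t + y) - t"
  let ?T = "{y. y < X \<and> t + y \<in> good}" and ?G = "{x. s + x \<in> good}"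
  note shift = good_shift[OF s] good_shift[OF t]
  obtain L where L: "\<And>x. x < 2 ^ m \<Longrightarrow> L x < 2 ^ m"
    "\<And>x y. x < 2 ^ m \<Longrightarrow> y < 2 ^ m \<Longrightarrow> L (x XOR y) = L x XOR L y"
    "\<And>x. x \<in> ?G \<Longrightarrow> x < 2 ^ m \<Longrightarrow> L x = ?\<sigma> x"
  proof (rule linear_extension[of ?\<tau> ?T m ?G ?\<sigma>])
    show "inj_on ?\<tau> ?T"
    proof (rule inj_onI)
      fix x y assume xy: "x \<in> ?T" "y \<in> ?T" and eq: "?\<tau> x = ?\<tau> y"
      have "\<pi> (t + x) = t + ?\<tau> x" by (rule shift(4)[symmetric]) (use xy in auto)
      also have "\<dots> = t + ?\<tau> y" by (simp only: eq)
      also have "\<dots> = \<pi> (t + y)" by (rule shift(4)) (use xy in auto)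
      finally have "\<pi> (t + x) = \<pi> (t + y)" .
      then show "x = y" by (simp add: \<pi>_eq_iff)
    qed
    show "2 * card {x \<in> {..<2 ^ m}. x \<notin> ?G} < 2 ^ m"
      using few_bad_shift[OF s] X by simp
    fix a assume a: "a \<in> ?G" "a < 2 ^ m"
    have "card {b \<in> {..<X}. \<not> (b \<in> ?T \<and> dotp m (?\<sigma> a) (?\<tau> b) = dotp m a b)} < Y"
    proof (rule close_row[OF _ t, of "s + a"])
      fix y assume y: "y < X" "\<not> (y \<in> ?T \<and> dotp m (?\<sigma> a) (?\<tau> y) = dotp m a y)" "t + y \<in> good"
      then have "dotp m (?\<sigma> a) (?\<tau> y) \<noteq> dotp m a y" by blast
      then have "adj (s + ?\<sigma> a) (t + ?\<tau> y) \<noteq> adj (s + a) (t + y)"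
        using a y shift(1)[of a] shift(3)[of y] X adj_shift[OF s t st] by simp
      then show "adj (s + a) (t + y) \<noteq> adj (\<pi> (s + a)) (\<pi> (t + y))"
        using a y shift(2)[of a] shift(4)[of y] X by simp
    qed (use a in simp)
    then show "16 * card {b \<in> {..<2 ^ m}. \<not> (b \<in> ?T \<and> dotp m (?\<sigma> a) (?\<tau> b) = dotp m a b)} \<le> 2 ^ m"
      using XY by (simp flip: X)
  qed (use shift X in auto)
  show ?thesis
    by (rule that[of L]) (use L X shift in auto)
qed

lemma good_fixed:
  assumes "v \<in> good" "v < 2 * X"
  shows "\<pi> v = v"
proof -
  \<comment> \<open>\<open>L\<close> is the action on A, tested against B; \<open>M\<close> is the
    action on B, tested against A because adjacency inside B is given by the path form.\<close>
  obtain L where L: "\<And>x. x < X \<Longrightarrow> L x < X"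
    "\<And>x y. x < X \<Longrightarrow> y < X \<Longrightarrow> L (x XOR y) = L x XOR L y"
    "\<And>x. x < X \<Longrightarrow> 0 + x \<in> good \<Longrightarrow> 0 + L x = \<pi> (0 + x)"
    by (rule linear_part[of 0 X]) (simp, simp, simp, rule that)
  obtain M where M: "\<And>x. x < X \<Longrightarrow> M x < X"
    "\<And>x y. x < X \<Longrightarrow> y < X \<Longrightarrow> M (x XOR y) = M x XOR M y"
    "\<And>x. x < X \<Longrightarrow> X + x \<in> good \<Longrightarrow> X + M x = \<pi> (X + x)"
    by (rule linear_part[of X 0]) (simp, simp, simp, rule that)
  have M0: "M 0 = 0" using M(2)[of 0 0] X_pos by simp
  note xor_less = xor_less_power[of _ m, folded X]
  have LL: "dotp m (L x) (L y) = dotp m x y" if "x < X" "y < X" for x y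
  proof -
    have "\<not> (dotp m (L x) (L y) \<noteq> dotp m x y)"
    proof (rule preserved_extend[where s = 0 and t = 0])
      fix x y assume xy: "x < X" "y < X" "0 + x \<in> good" "0 + y \<in> good"
        "adj (0 + x) (0 + y) = adj (\<pi> (0 + x)) (\<pi> (0 + y))"
      then have "adj (0 + x) (0 + y) = adj (0 + L x) (0 + L y)"
        by (simp only: L(3))
      then show "\<not> (dotp m (L x) (L y) \<noteq> dotp m x y)"
        using L(1) xy(1,2) by (simp add: adj_low)
    next
      show "affine_below m (\<lambda>x. dotp m (L x) (L y) \<noteq> dotp m x y)" if "y < X" for y
        using L(2) by (auto simp: affine_below_def dotp_xor xor_less simp flip: X)
      show "affine_below m (\<lambda>y. dotp m (L x) (L y) \<noteq> dotp m x y)" if "x < X" for x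
        using L(2) by (auto simp: affine_below_def dotp_xor_right xor_less simp flip: X)
    qed (use that in auto)
    then show ?thesis by simp
  qed
  have LM: "dotp m (L x) (M y) = dotp m x y" if "x < X" "y < X" for x y
  proof -
    have "\<not> (dotp m (L x) (M y) \<noteq> dotp m x y)"
    proof (rule preserved_extend[where s = 0 and t = X])
      fix x y assume xy: "x < X" "y < X" "0 + x \<in> good" "X + y \<in> good"
        "adj (0 + x) (X + y) = adj (\<pi> (0 + x)) (\<pi> (X + y))"
      then have "adj (0 + x) (X + y) = adj (0 + L x) (X + M y)"
        by (simp only: L(3) M(3))
      then show "\<not> (dotp m (L x) (M y) \<noteq> dotp m x y)"
        using L(1) M(1) xy(1,2) by (simp add: adj_low dotp_add_right)
    next
      show "affine_below m (\<lambda>x. dotp m (L x) (M y) \<noteq> dotp m x y)" if "y < X" for y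
        using L(2) by (auto simp: affine_below_def dotp_xor xor_less simp flip: X)
      show "affine_below m (\<lambda>y. dotp m (L x) (M y) \<noteq> dotp m x y)" if "x < X" for x
        using M(2) by (auto simp: affine_below_def dotp_xor_right xor_less simp flip: X)
    qed (use that in auto)
    then show ?thesis by simp
  qed
  have MM: "pathp m (M x) (M y) = pathp m x y" if "x < X" "y < X" for x y
  proof -
    have pr: "pathp m w (x XOR y XOR z) = (pathp m w x \<noteq> (pathp m w y \<noteq> pathp m w z))" for w x y z
      using pathp_xor[of m x y z w] by (simp add: pathp_commute[of m w])
    have "\<not> (pathp m (M x) (M y) \<noteq> pathp m x y)"
    proof (rule preserved_extend[where s = X and t = X])
      fix x y assume xy: "x < X" "y < X" "X + x \<in> good" "X + y \<in> good"
        "adj (X + x) (X + y) = adj (\<pi> (X + x)) (\<pi> (X + y))"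
      then have "adj (X + x) (X + y) = adj (X + M x) (X + M y)"
        by (simp only: M(3))
      then show "\<not> (pathp m (M x) (M y) \<noteq> pathp m x y)"
        using M(1) xy(1,2) by (simp add: adj_mid)
    next
      show "affine_below m (\<lambda>x. pathp m (M x) (M y) \<noteq> pathp m x y)" if "y < X" for y
        using M(2) by (auto simp: affine_below_def pathp_xor xor_less simp flip: X)
      show "affine_below m (\<lambda>y. pathp m (M x) (M y) \<noteq> pathp m x y)" if "x < X" for x
        using M(2) by (auto simp: affine_below_def pr xor_less simp flip: X)
    qed (use that in auto)
    then show ?thesis by simp
  qed
  have id: "L x = x" "M x = x" if "x < X" for x
    by (rule path_rigid_pair[of m L M, folded X]; use L(1) M(1) M0 LL LM MM that in blast)+
  show ?thesis
  proof (cases "v < X")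
    case True
    with id(1)[of v] L(3)[of v] assms(1) show ?thesis by simp
  next
    case False
    with id(2)[of "v - X"] M(3)[of "v - X"] assms show ?thesis by simp
  qed
qed

text \<open>If a good \<open>v\<close> moves, it stays in its block, so its row and that of its
  image differ in at least \<open>Y\<close> places of A and B. Good vertices there are fixed, so
  each such place is a bad vertex or a mismatch of \<open>v\<close>: fewer than \<open>Y\<close> in
  all.\<close>

lemma good_fixed_all:
  assumes "v \<in> good"
  shows "\<pi> v = v"
proof (rule ccontr)
  assume moved: "\<pi> v \<noteq> v"
  have v: "v \<le> n" using assms by simp
  let ?R = "{w \<in> {..<2 * X}. adj v w \<noteq> adj (\<pi> v) w}"
  have "Y \<le> card ?R"
    by (rule row_distance) (use v moved good_same_block[OF assms] \<pi>_le in auto)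
  also have "?R \<subseteq> ({..n} - good) \<union> mismatches v"
  proof
    fix w assume w: "w \<in> ?R"
    then have "w \<le> n" using n_lower by simp
    with w good_fixed[of w] show "w \<in> ({..n} - good) \<union> mismatches v"
      by (cases "w \<in> good") (auto simp: mismatches_def)
  qed
  then have "card ?R \<le> card (({..n} - good) \<union> mismatches v)"
    by (rule card_mono[rotated]) simp
  also have "\<dots> \<le> card ({..n} - good) + card (mismatches v)"
    by (rule card_Un_le)
  also have "\<dots> < Y"
    using assms few_bad by simp
  finally show False by simp
qed

end

lemma moved_le_mismatches:
  "Y * card {v \<in> {..n}. \<pi> v \<noteq> v} \<le> 4096 * (\<Sum>v\<le>n. card (mismatches v))"
proof -
  define D where "D = (\<Sum>v\<le>n. card (mismatches v))"
  have bad: "Y * card ({..n} - good) \<le> 2 * D"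
  proof -
    have "Y * card ({..n} - good) = (\<Sum>v\<in>{..n} - good. Y)" by simp
    also have "\<dots> \<le> (\<Sum>v\<in>{..n} - good. 2 * card (mismatches v))"
      by (rule sum_mono) auto
    also have "\<dots> \<le> (\<Sum>v\<le>n. 2 * card (mismatches v))"
      by (rule sum_mono2) auto
    finally show ?thesis by (simp add: D_def sum_distrib_left)
  qed
  have "Y * card {v \<in> {..n}. \<pi> v \<noteq> v} \<le> 4096 * D"
  \<comment> \<open>If \<open>D\<close> is small, averaging leaves at most \<open>Y / 8\<close> bad
    vertices, and only these can move. Otherwise the trivial bound of \<open>256 * Y\<close> moved
    vertices suffices, with \<open>4096 = 16 * 256\<close>.\<close>
  proof (cases "16 * D \<le> Y * Y")
    case True
    have "Y * (8 * card ({..n} - good)) = 8 * (Y * card ({..n} - good))"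
      by (rule mult.left_commute)
    also have "\<dots> \<le> 8 * (2 * D)"
      by (rule mult_le_mono2) (rule bad)
    also have "\<dots> \<le> Y * Y" using True by simp
    finally have "Y * (8 * card ({..n} - good)) \<le> Y * Y" .
    then have "8 * card ({..n} - good) \<le> Y" using Y_pos by (simp only: mult_le_cancel1)
    then have "{v \<in> {..n}. \<pi> v \<noteq> v} \<subseteq> {..n} - good"
      using good_fixed_all by blast
    then have "card {v \<in> {..n}. \<pi> v \<noteq> v} \<le> card ({..n} - good)"
      by (rule card_mono[rotated]) simp
    then have "Y * card {v \<in> {..n}. \<pi> v \<noteq> v} \<le> Y * card ({..n} - good)"
      by (rule mult_le_mono2)
    also have "\<dots> \<le> 2 * D" by (rule bad)
    finally show ?thesis by simp
  next
    case False
    have "card {v \<in> {..n}. \<pi> v \<noteq> v} \<le> card {1..n}"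
      by (rule card_mono) (use \<pi> in \<open>auto simp: permutes_def\<close>)
    also have "\<dots> \<le> 256 * Y" using n_upper XY by simp
    finally have "Y * card {v \<in> {..n}. \<pi> v \<noteq> v} \<le> Y * (256 * Y)"
      by (rule mult_le_mono2)
    also have "\<dots> = 256 * (Y * Y)" by simp
    also have "\<dots> \<le> 4096 * D" using False by simp
    finally show ?thesis .
  qed
  then show ?thesis by (simp add: D_def)
qed

end

section \<open>Turing machines simulating automata\<close>

definition tape_content :: "nat list \<Rightarrow> int \<Rightarrow> nat" where
  "tape_content w = (\<lambda>i. if 0 \<le> i \<and> nat i < length w then w ! nat i else 0)"

abbreviation blen :: "nat \<Rightarrow> nat" where
  "blen x \<equiv> length (binary x)"

lemma binary_0 [simp]: "binary 0 = []"
  by (simp add: binary.simps)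

lemma binary_pos: "0 < x \<Longrightarrow> binary x = binary (x div 2) @ [if odd x then 2 else 1]"
  by (subst binary.simps) simp

lemma binary_symbols: "set (binary x) \<subseteq> {1, 2}"
proof (induction x rule: less_induct)
  case (less x)
  then show ?case
    by (cases "x = 0") (auto simp: binary_pos)
qed

lemma rev_binary_nth: "i < blen x \<Longrightarrow> rev (binary x) ! i = (if bit x i then 2 else 1)"
proof (induction x arbitrary: i rule: less_induct)
  case (less x)
  then have "0 < x" by (cases "x = 0") auto
  with less show ?case
    by (cases i) (auto simp: binary_pos bit_0 bit_Suc)
qed

lemma blen_bounds: "0 < x \<Longrightarrow> 2 ^ (blen x - 1) \<le> x" "x < 2 ^ blen x"
proof -
  have "(0 < x \<longrightarrow> 2 ^ (blen x - 1) \<le> x) \<and> x < 2 ^ blen x"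
  proof (induction x rule: less_induct)
    case (less x)
    show ?case
    proof (cases "x < 2")
      case True
      then show ?thesis by (cases "x = 0") (auto simp: binary_pos less_2_cases_iff)
    next
      case False
      then have "x div 2 < x" "0 < x div 2" by auto
      moreover from this have "0 < blen (x div 2)" by (simp add: binary_pos)
      ultimately show ?thesis
        using less[of "x div 2"] False by (cases "blen (x div 2)") (auto simp: binary_pos)
    qed
  qed
  then show "0 < x \<Longrightarrow> 2 ^ (blen x - 1) \<le> x" "x < 2 ^ blen x" by auto
qed

lemma bit_imp_less_blen: "bit x i \<Longrightarrow> i < blen x"
  by (metis blen_bounds(2) bit_take_bit_iff take_bit_nat_eq_self_iff)

text \<open>Moving left from the last digit, a head meets the bits in increasing significance and
  then blanks.\<close>

lemma tape_content_binary:
  "tape_content (binary x) (int (blen x) - 1 - int i) =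
    (if i < blen x then if bit x i then 2 else 1 else 0)"
proof (cases "i < blen x")
  case True
  then have "tape_content (binary x) (int (blen x) - 1 - int i) = rev (binary x) ! i"
    by (auto simp: tape_content_def rev_nth nat_diff_distrib intro!: arg_cong[where f = "(!) (binary x)"])
  with True show ?thesis by (simp add: rev_binary_nth)
qed (simp add: tape_content_def)

lemma blen_mono: "x \<le> y \<Longrightarrow> blen x \<le> blen y"
proof (cases "x = 0")
  case False
  assume "x \<le> y"
  have "2 ^ (blen x - 1) \<le> y"
    using blen_bounds(1)[of x] False \<open>x \<le> y\<close> by simp
  then have "(2::nat) ^ (blen x - 1) < 2 ^ blen y"
    using blen_bounds(2)[of y] by (rule le_less_trans)
  then have "blen x - 1 < blen y"
    by (rule power_less_imp_less_exp[rotated]) simp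
  then show ?thesis by simp
qed simp

lemma blen_le_log: "0 < x \<Longrightarrow> real (blen x) \<le> log 2 (real x) + 1"
proof -
  assume "0 < x"
  then have "real (2 ^ (blen x - 1)) \<le> real x"
    using blen_bounds(1) of_nat_le_iff by blast
  then have "log 2 (2 ^ (blen x - 1)) \<le> log 2 (real x)"
    using \<open>0 < x\<close> by (subst log_le_cancel_iff) auto
  moreover have "0 < blen x" using \<open>0 < x\<close> by (simp add: binary_pos)
  ultimately show ?thesis by (simp add: log_nat_power)
qed

section \<open>Copying each input number to its own tape\<close>

lemma tm_step_map:
  assumes "q < length (instrs M)" "length ts = k"
    and "(instrs M ! q) (map scanned ts) = (q', map g [0..<k])"
  shows "tm_step M (q, ts) = (q', map (\<lambda>i. act (g i) (ts ! i)) [0..<k])"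
  using assms by (auto intro!: nth_equalityI)

lemma act_stay: "act (scanned t, Stay) t = t"
  by (cases t) simp

text \<open>The instruction of state \<open>j - 1\<close>. Any symbol other than a digit ends the
  copy: the input head passes it, and the head of tape \<open>j\<close> steps back onto the last
  digit, the least significant one.\<close>

definition copy_instr :: "nat \<Rightarrow> instr" where
  "copy_instr j as =
    (let copying = as ! 0 \<in> {1, 2}
     in (if copying then j - 1 else j,
         map (\<lambda>i. if i = 0 then (as ! 0, Go_Right)
                  else if i = j then (if copying then (as ! 0, Go_Right) else (as ! j, Go_Left))
                  else (as ! i, Stay)) [0..<4]))"

lemma copy_step:
  assumes M: "j - 1 < length (instrs M)" "instrs M ! (j - 1) = copy_instr j"
    and ts: "length ts = 4" "ts ! 0 = (c, h)" "ts ! j = (d, k)" and j: "0 < j" "j < 4"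
  shows "tm_step M (j - 1, ts) =
    (if c h \<in> {1, 2} then (j - 1, ts[0 := (c, h + 1), j := (d(k := c h), k + 1)])
     else (j, ts[0 := (c, h + 1), j := (d, k - 1)]))"
proof -
  let ?g = "\<lambda>i. if i = 0 then (c h, Go_Right)
    else if i = j then (if c h \<in> {1, 2} then (c h, Go_Right) else (d k, Go_Left))
    else (scanned (ts ! i), Stay)"
  have nth: "i < 4 \<Longrightarrow> map scanned ts ! i = scanned (ts ! i)" for i
    using ts(1) by simp
  have "tm_step M (j - 1, ts) =
      (if c h \<in> {1, 2} then j - 1 else j, map (\<lambda>i. act (?g i) (ts ! i)) [0..<4])"
    by (rule tm_step_map[OF M(1) ts(1)])
      (use ts j in \<open>auto simp: M(2)[simplified] copy_instr_def Let_def nth intro!: map_cong\<close>)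
  also have "map (\<lambda>i. act (?g i) (ts ! i)) [0..<4] =
      (if c h \<in> {1, 2} then ts[0 := (c, h + 1), j := (d(k := c h), k + 1)]
       else ts[0 := (c, h + 1), j := (d, k - 1)])"
    by (rule nth_equalityI) (use ts j in \<open>auto simp: nth_list_update act_stay simp del: One_nat_def\<close>)
  finally show ?thesis by simp
qed

lemma list_update_pair_overwrite: "i \<noteq> j \<Longrightarrow> xs[i := a, j := b, i := c, j := d] = xs[i := c, j := d]"
  by (metis list_update_overwrite list_update_swap)

lemma copy_phase:
  assumes M: "j - 1 < length (instrs M)" "instrs M ! (j - 1) = copy_instr j"
    and ts: "length ts = 4" "ts ! 0 = (c, h)" "ts ! j = blank_tape" and j: "0 < j" "j < 4"
    and w: "set w \<subseteq> {1, 2}" "\<And>i. i < length w \<Longrightarrow> c (h + int i) = w ! i"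
    and stop: "c (h + int (length w)) \<notin> {1, 2}"
  shows "(tm_step M ^^ (length w + 1)) (j - 1, ts) =
    (j, ts[0 := (c, h + int (length w) + 1), j := (tape_content w, int (length w) - 1)])"
proof -
  have copied: "i \<le> length w \<Longrightarrow> (tm_step M ^^ i) (j - 1, ts) =
      (j - 1, ts[0 := (c, h + int i), j := (tape_content (take i w), int i)])" for i
  proof (induction i)
    case 0
    have "tape_content [] = (\<lambda>_. 0)" by (auto simp: tape_content_def)
    then show ?case using ts j by (simp add: blank_tape_def flip: ts) (metis list_update_id ts(2,3) blank_tape_def)
  next
    case (Suc i)
    have upd: "(tape_content (take i w))(int i := w ! i) = tape_content (take (Suc i) w)"
      using Suc.prems by (auto simp: tape_content_def fun_eq_iff nth_append take_Suc_conv_app_nth)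
    have in12: "c (h + int i) \<in> {1, 2}"
      using w Suc.prems by (metis Suc_le_lessD nth_mem subsetD)
    have "(tm_step M ^^ Suc i) (j - 1, ts) =
        tm_step M (j - 1, ts[0 := (c, h + int i), j := (tape_content (take i w), int i)])"
      using Suc by simp
    also have "\<dots> = (j - 1, ts[0 := (c, h + int (Suc i)), j := (tape_content (take (Suc i) w), int (Suc i))])"
      using in12 ts j Suc.prems upd
      by (subst copy_step[OF M, where c = c and h = "h + int i" and d = "tape_content (take i w)" and k = "int i"])
        (auto simp: w(2) list_update_pair_overwrite algebra_simps)
    finally show ?case .
  qed
  have "(tm_step M ^^ (length w + 1)) (j - 1, ts) =
      tm_step M (j - 1, ts[0 := (c, h + int (length w)), j := (tape_content w, int (length w))])"
    using copied[of "length w"] by simp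
  also have "\<dots> = (j, ts[0 := (c, h + int (length w) + 1), j := (tape_content w, int (length w) - 1)])"
    using stop ts j
    by (subst copy_step[OF M, where c = c and h = "h + int (length w)" and d = "tape_content w" and k = "int (length w)"])
      (auto simp: list_update_pair_overwrite)
  finally show ?thesis .
qed

section \<open>Simulating a finite automaton on the copied numbers\<close>

context
  fixes \<delta> :: "'q::finite \<Rightarrow> bool \<Rightarrow> bool \<Rightarrow> 'q" and init :: 'q and accept :: "'q \<Rightarrow> bool"
begin

text \<open>
  The initial state gets index 0 because the copying phase ends in machine state 3, where the
  simulation of the automaton starts.
\<close>

definition state_index :: "'q \<Rightarrow> nat" where
  "state_index = (SOME f. bij_betw f UNIV {..<card (UNIV :: 'q set)} \<and> f init = 0)"

lemma state_index: "bij_betw state_index UNIV {..<card (UNIV :: 'q set)}" "state_index init = 0"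
proof -
  obtain f :: "'q \<Rightarrow> nat" where f: "bij_betw f UNIV {..<card (UNIV :: 'q set)}"
    using ex_bij_betw_finite_nat[of "UNIV :: 'q set"] by (auto simp: atLeast0LessThan)
  have "transpose 0 (f init) permutes {..<card (UNIV :: 'q set)}"
    using f by (intro permutes_swap_id) (auto simp: bij_betw_def card_gt_0_iff)
  then have "bij_betw (transpose 0 (f init) \<circ> f) UNIV {..<card (UNIV :: 'q set)}"
    by (intro bij_betw_trans[OF f] permutes_imp_bij)
  moreover have "(transpose 0 (f init) \<circ> f) init = 0" by simp
  ultimately have "\<exists>f. bij_betw f UNIV {..<card (UNIV :: 'q set)} \<and> f init = 0" by blast
  from someI_ex[OF this, folded state_index_def]
  show "bij_betw state_index UNIV {..<card (UNIV :: 'q set)}" "state_index init = 0" by auto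
qed

text \<open>A blank on tape 1 means that the digits of \<open>n\<close> are exhausted. Testing for
  the symbol 2 reads a blank as bit 0, which pads \<open>u\<close> and \<open>v\<close> with leading
  zeros. With three copying instructions, the offsets 3 and 4 give the accepting and the rejecting
  state.\<close>

definition run_instr :: "nat \<Rightarrow> instr" where
  "run_instr i as =
    (let q = inv state_index i
     in if as ! 1 = 0
        then (card (UNIV :: 'q set) + (if accept q then 3 else 4), map (\<lambda>i. (as ! i, Stay)) [0..<4])
        else (3 + state_index (\<delta> q (as ! 2 = 2) (as ! 3 = 2)),
              map (\<lambda>i. (as ! i, if i = 0 then Stay else Go_Left)) [0..<4]))"

definition automaton_tm :: tm where
  "automaton_tm = \<lparr>tape_count = 4, symbol_count = 4,
     instrs = map copy_instr [1, 2, 3] @ map run_instr [0..<card (UNIV :: 'q set)]\<rparr>"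

lemma length_instrs: "length (instrs automaton_tm) = 3 + card (UNIV :: 'q set)"
  by (simp add: automaton_tm_def)

lemma state_index_less: "state_index q < card (UNIV :: 'q set)"
  using state_index by (auto simp: bij_betw_def)

lemma inv_state_index: "inv state_index (state_index q) = q"
  using state_index by (simp add: bij_betw_def)

lemma well_formed_automaton_tm: "well_formed_tm automaton_tm"
proof -
  have sym: "as ! i < 4" if "length as = 4" "set as \<subseteq> {..<4}" "i < 4" for as :: "nat list" and i
    using that by (metis lessThan_iff nth_mem subsetD)
  define ok :: "instr \<Rightarrow> bool" where "ok f \<longleftrightarrow>
    (\<forall>as. length as = 4 \<and> set as \<subseteq> {..<4} \<longrightarrow> (case f as of (q, acts) \<Rightarrow>
      q \<le> 4 + card (UNIV :: 'q set) \<and> length acts = 4 \<and> fst ` set acts \<subseteq> {..<4}))" for f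
  have "ok (copy_instr j)" if "j < 4" for j
    using that sym by (auto simp: ok_def copy_instr_def Let_def)
  moreover have "ok (run_instr j)" for j
    using sym state_index_less[THEN less_imp_le, THEN le_SucI]
    by (auto simp: ok_def run_instr_def Let_def)
  ultimately have "\<forall>f \<in> set (instrs automaton_tm). ok f"
    by (auto simp: automaton_tm_def)
  then show ?thesis
    by (simp add: well_formed_tm_def ok_def rejecting_state_def length_instrs)
      (simp add: automaton_tm_def)
qed

lemma run_phase:
  fixes t :: tape and n :: nat
  assumes F: "F 0 = init" "\<And>i. F (Suc i) = \<delta> (F i) (bit u i) (bit v i)"
  defines "tapes \<equiv> \<lambda>i. [t, (tape_content (binary n), int (blen n) - 1 - int i),
      (tape_content (binary u), int (blen u) - 1 - int i), (tape_content (binary v), int (blen v) - 1 - int i)]"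
  shows "fst ((tm_step automaton_tm ^^ (blen n + 1)) (3 + state_index init, tapes 0)) =
    card (UNIV :: 'q set) + (if accept (F (blen n)) then 3 else 4)"
proof -
  have instr: "3 + state_index q < length (instrs automaton_tm)"
    "instrs automaton_tm ! (3 + state_index q) = run_instr (state_index q)" for q
    using state_index_less[of q] by (simp_all add: automaton_tm_def nth_append)
  have upt4: "[0..<4] = [0, 1, 2, 3]"
    by (simp add: upt_rec)
  have two: "tape_content (binary x) (int (blen x) - 1 - int i) = 2 \<longleftrightarrow> bit x i" for x i
    using bit_imp_less_blen[of x i] by (auto simp: tape_content_binary)
  have run: "i \<le> blen n \<Longrightarrow> (tm_step automaton_tm ^^ i) (3 + state_index init, tapes 0) =
      (3 + state_index (F i), tapes i)" for i
  proof (induction i)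
    case 0
    then show ?case by (simp add: F)
  next
    case (Suc i)
    have "tape_content (binary n) (int (blen n) - 1 - int i) \<noteq> 0"
      using Suc.prems by (simp add: tape_content_binary)
    then have "tm_step automaton_tm (3 + state_index (F i), tapes i) =
        (3 + state_index (F (Suc i)), tapes (Suc i))"
      using instr[of "F i"]
      by (simp add: tapes_def run_instr_def inv_state_index two F(2) upt4 del: of_nat_Suc)
        (simp add: act_stay algebra_simps)
    with Suc show ?case by simp
  qed
  have "tape_content (binary n) (int (blen n) - 1 - int (blen n)) = 0"
    by (simp add: tape_content_def)
  then have "fst (tm_step automaton_tm (3 + state_index (F (blen n)), tapes (blen n))) =
      card (UNIV :: 'q set) + (if accept (F (blen n)) then 3 else 4)"
    using instr[of "F (blen n)"] by (simp add: tapes_def run_instr_def inv_state_index)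
  with run[of "blen n"] show ?thesis by simp
qed

lemma automaton_tm_decides:
  assumes "F 0 = init" "\<And>i. F (Suc i) = \<delta> (F i) (bit u i) (bit v i)"
    and T: "real (2 * blen n + blen u + blen v + 4) \<le> T"
  shows "decides_within automaton_tm (encode_triple n u v) (accept (F (blen n))) T"
proof -
  let ?w = "encode_triple n u v" and ?M = automaton_tm
  let ?c = "tape_content ?w"
  have tape: "input_tape ?w = (?c, 0)"
    by (simp add: input_tape_def tape_content_def)
  have start: "start_config ?M ?w = (1 - 1, [(?c, 0), blank_tape, blank_tape, blank_tape])"
    by (simp add: start_config_def tape automaton_tm_def eval_nat_numeral)
  have instr: "j - 1 < length (instrs ?M)" "instrs ?M ! (j - 1) = copy_instr j"
    if "j \<in> {1, 2, 3}" for j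
    using that by (auto simp: automaton_tm_def nth_append)
  have c: "?c (int i) = (if i < length ?w then ?w ! i else 0)" for i
    by (simp add: tape_content_def)
  have c1: "i < blen n \<Longrightarrow> ?c (0 + int i) = binary n ! i" for i
    by (simp only: c add_0) (simp add: encode_triple_def nth_append)
  have s1: "?c (0 + int (blen n)) = 3"
    by (simp only: c add_0) (simp add: encode_triple_def nth_append)
  have c2: "i < blen u \<Longrightarrow> ?c (0 + int (blen n) + 1 + int i) = binary u ! i" for i
    using c[of "blen n + 1 + i"] by (simp add: encode_triple_def nth_append algebra_simps)
  have s2: "?c (0 + int (blen n) + 1 + int (blen u)) = 3"
    using c[of "blen n + 1 + blen u"] by (simp add: encode_triple_def nth_append algebra_simps)
  have c3: "i < blen v \<Longrightarrow> ?c (0 + int (blen n) + 1 + int (blen u) + 1 + int i) = binary v ! i" for i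
    using c[of "blen n + 1 + blen u + 1 + i"] by (simp add: encode_triple_def nth_append algebra_simps)
  have s3: "?c (0 + int (blen n) + 1 + int (blen u) + 1 + int (blen v)) = 0"
    using c[of "blen n + 1 + blen u + 1 + blen v"] by (simp add: encode_triple_def algebra_simps)
  let ?tn = "(tape_content (binary n), int (blen n) - 1)" and ?tu = "(tape_content (binary u), int (blen u) - 1)"
    and ?tv = "(tape_content (binary v), int (blen v) - 1)"
  have 1: "(tm_step ?M ^^ (blen n + 1)) (1 - 1, [(?c, 0), blank_tape, blank_tape, blank_tape]) =
      (2 - 1, [(?c, 0 + int (blen n) + 1), ?tn, blank_tape, blank_tape])"
    by (subst copy_phase[OF instr, where c = ?c and h = 0 and w = "binary n"])
      (use binary_symbols c1 s1 in auto)
  have 2: "(tm_step ?M ^^ (blen u + 1)) (2 - 1, [(?c, 0 + int (blen n) + 1), ?tn, blank_tape, blank_tape]) =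
      (3 - 1, [(?c, 0 + int (blen n) + 1 + int (blen u) + 1), ?tn, ?tu, blank_tape])"
    by (subst copy_phase[OF instr, where c = ?c and h = "0 + int (blen n) + 1" and w = "binary u"])
      (use binary_symbols c2 s2 in auto)
  have 3: "(tm_step ?M ^^ (blen v + 1))
      (3 - 1, [(?c, 0 + int (blen n) + 1 + int (blen u) + 1), ?tn, ?tu, blank_tape]) =
      (3, [(?c, 0 + int (blen n) + 1 + int (blen u) + 1 + int (blen v) + 1), ?tn, ?tu, ?tv])"
    by (subst copy_phase[OF instr, where c = ?c and h = "0 + int (blen n) + 1 + int (blen u) + 1" and w = "binary v"])
      (use binary_symbols c3 s3 in auto)
  have chain: "(g ^^ (b + a)) x = z" if "(g ^^ a) x = y" "(g ^^ b) y = z"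
    for g :: "config \<Rightarrow> config" and a b x y z
    using that by (simp add: funpow_add)
  \<comment> \<open>Three copying phases and one run, each one step longer than its number of
    digits.\<close>
  have "(tm_step ?M ^^ ((blen n + 1) + ((blen v + 1) + ((blen u + 1) + (blen n + 1))))) (start_config ?M ?w) =
      (tm_step ?M ^^ (blen n + 1))
        (3, [(?c, 0 + int (blen n) + 1 + int (blen u) + 1 + int (blen v) + 1), ?tn, ?tu, ?tv])"
    unfolding start by (rule chain[OF chain[OF chain[OF 1 2] 3] refl])
  moreover have "fst \<dots> = card (UNIV :: 'q set) + (if accept (F (blen n)) then 3 else 4)"
    using run_phase[OF assms(1,2), where n = n] by (simp add: state_index)
  ultimately have "fst ((tm_step ?M ^^ (2 * blen n + blen u + blen v + 4)) (start_config ?M ?w)) =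
      (if accept (F (blen n)) then accepting_state ?M else rejecting_state ?M)"
    by (simp add: accepting_state_def rejecting_state_def length_instrs algebra_simps eval_nat_numeral del: funpow.simps)
  then show ?thesis
    using T unfolding decides_within_def by blast
qed

end

section \<open>The graph family\<close>

text \<open>For \<open>i \<ge> 4\<close> these are the bits \<open>i - 1\<close> down to
  \<open>i - 4\<close>, expressed by \<open>prev_bit\<close> because that is what a
  \<open>snapshot\<close> stores.\<close>

definition window :: "nat \<Rightarrow> nat \<Rightarrow> bool \<times> bool \<times> bool \<times> bool" where
  "window i x = (prev_bit i x, prev_bit (i - 1) x, prev_bit (i - 2) x, prev_bit (i - 3) x)"

text \<open>
  The relation \<open>adj\<close> in terms of single bits, with \<open>A\<close> and \<open>B\<close> the blocks of leading bits 0000 and 0001.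
  It is total in \<open>l\<close>: for small \<open>l\<close> the subtractions truncate.
\<close>

definition edge_rel :: "nat \<Rightarrow> nat \<Rightarrow> nat \<Rightarrow> bool" where
  "edge_rel l u v =
    (let A = (False, False, False, False); B = (False, False, False, True);
         p = window l u; q = window l v
     in if p = B \<and> q = B then pathp (l - 4) u v
        else if p = A \<or> q = A then dotp (l - 4) u v
        else if p = B then window (l - 4) u \<noteq> q
        else if q = B then window (l - 4) v \<noteq> p
        else False)"

definition edges :: "nat \<Rightarrow> nat set set" where
  "edges n = {{u, v} | u v. u \<in> {1..n} \<and> v \<in> {1..n} \<and> u \<noteq> v \<and> edge_rel (blen n) u v}"

lemma edge_rel_commute: "edge_rel l u v = edge_rel l v u"
  by (auto simp: edge_rel_def Let_def dotp_commute pathp_commute)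

lemma in_edges_iff:
  "u \<in> {1..n} \<Longrightarrow> v \<in> {1..n} \<Longrightarrow> {u, v} \<in> edges n \<longleftrightarrow> u \<noteq> v \<and> edge_rel (blen n) u v"
  by (auto simp: edges_def doubleton_eq_iff edge_rel_commute)

lemma simple_graph_edges: "simple_graph {1..n} (edges n)"
  by (auto simp: simple_graph_def edges_def)

lemma finite_edges: "finite (edges n)"
  by (rule finite_subset[of _ "Pow {1..n}"]) (auto simp: edges_def)

text \<open>Products of \<open>bool\<close> make the state type of the automaton an instance of
  \<open>finite\<close>.\<close>

type_synonym snapshot = "bool \<times> bool \<times> bool \<times> bool"

type_synonym history = "bool \<times> snapshot \<times> snapshot \<times> snapshot \<times> snapshot \<times>
  snapshot \<times> snapshot \<times> snapshot \<times> snapshot"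

definition snapshot :: "nat \<Rightarrow> nat \<Rightarrow> nat \<Rightarrow> snapshot" where
  "snapshot u v i = (dotp i u v, pathp i u v, prev_bit i u, prev_bit i v)"

fun snapshot_step :: "snapshot \<Rightarrow> bool \<Rightarrow> bool \<Rightarrow> snapshot" where
  "snapshot_step (d, p, a, b) x y = (d \<noteq> (x \<and> y), p \<noteq> ((x \<and> b) \<noteq> (y \<and> a)), x, y)"

text \<open>The flag \<open>e\<close> remembers whether the two inputs have differed; acceptance
  requires it, so that \<open>u = v\<close> is rejected.\<close>

fun history_step :: "history \<Rightarrow> bool \<Rightarrow> bool \<Rightarrow> history" where
  "history_step (e, s0, s1, s2, s3, s4, s5, s6, s7) x y =
    (e \<or> x \<noteq> y, snapshot_step s0 x y, s0, s1, s2, s3, s4, s5, s6)"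

text \<open>
  The block of a vertex is read off its four leading bits and the form values refer to the bits below
  them, but the automaton does not know when \<open>n\<close> ends; so it remembers its last eight snapshots. For
  \<open>i < 7\<close> truncated subtraction repeats snapshot 0, in agreement with \<open>edge_rel\<close>.
\<close>

definition history :: "nat \<Rightarrow> nat \<Rightarrow> nat \<Rightarrow> history" where
  "history u v i = (\<exists>j<i. bit u j \<noteq> bit v j, snapshot u v i, snapshot u v (i - 1),
    snapshot u v (i - 2), snapshot u v (i - 3), snapshot u v (i - 4), snapshot u v (i - 5),
    snapshot u v (i - 6), snapshot u v (i - 7))"

fun history_accepts :: "history \<Rightarrow> bool" where
  "history_accepts (e, (_, _, a0, b0), (_, _, a1, b1), (_, _, a2, b2), (_, _, a3, b3),
      (d, p, a4, b4), (_, _, a5, b5), (_, _, a6, b6), (_, _, a7, b7)) =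
    (e \<and> (let A = (False, False, False, False); B = (False, False, False, True);
         p1 = (a0, a1, a2, a3); q1 = (b0, b1, b2, b3)
     in if p1 = B \<and> q1 = B then p
        else if p1 = A \<or> q1 = A then d
        else if p1 = B then (a4, a5, a6, a7) \<noteq> q1
        else if q1 = B then (b4, b5, b6, b7) \<noteq> p1
        else False))"

lemma history_Suc: "history u v (Suc i) = history_step (history u v i) (bit u i) (bit v i)"
  by (auto simp: history_def snapshot_def less_Suc_eq numeral_eq_Suc)

lemma history_accepts:
  "history_accepts (history u v i) \<longleftrightarrow> (\<exists>j<i. bit u j \<noteq> bit v j) \<and> edge_rel i u v"
proof -
  have "i - 4 - 1 = i - 5" "i - 4 - 2 = i - 6" "i - 4 - 3 = i - 7" by simp_all
  then show ?thesis
    by (simp only: history_def snapshot_def history_accepts.simps edge_rel_def window_def Let_def)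
qed

lemma edges_decided:
  assumes "u \<in> {1..n}" "v \<in> {1..n}"
  shows "decides_within (automaton_tm history_step (history 0 0 0) history_accepts)
    (encode_triple n u v) ({u, v} \<in> edges n) (poly [:8, 4:] (log 2 (real n)))"
proof -
  let ?H = "history u v"
  have "u < 2 ^ blen n" "v < 2 ^ blen n"
    using assms blen_bounds(2)[of n] by auto
  then have "u \<noteq> v \<longleftrightarrow> (\<exists>j<blen n. bit u j \<noteq> bit v j)"
    using eqI_below by blast
  then have "history_accepts (?H (blen n)) \<longleftrightarrow> {u, v} \<in> edges n"
    using in_edges_iff[OF assms] by (simp add: history_accepts)
  moreover have "decides_within (automaton_tm history_step (history 0 0 0) history_accepts)
    (encode_triple n u v) (history_accepts (?H (blen n))) (poly [:8, 4:] (log 2 (real n)))"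
  proof (rule automaton_tm_decides)
    show "?H 0 = history 0 0 0" by (simp add: history_def snapshot_def)
    have "blen u \<le> blen n" "blen v \<le> blen n"
      using assms by (auto intro: blen_mono)
    then have "real (2 * blen n + blen u + blen v + 4) \<le> 4 * real (blen n) + 4"
      by simp
    moreover have "real (blen n) \<le> log 2 (real n) + 1"
      using assms by (intro blen_le_log) auto
    \<comment> \<open>\<open>4 * (log 2 n + 1) + 4\<close> is the value of \<open>[:8, 4:]\<close>
      at \<open>log 2 n\<close>.\<close>
    ultimately show "real (2 * blen n + blen u + blen v + 4) \<le> poly [:8, 4:] (log 2 (real n))"
      by (simp add: algebra_simps)
  qed (simp add: history_Suc)
  ultimately show ?thesis by simp
qed

text \<open>An element of \<open>S\<close> determines the unordered pair, and the truth value of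
  \<open>v < w\<close> its order.\<close>

lemma card_pairs_le:
  fixes \<pi> :: "'a::linorder \<Rightarrow> 'b"
  assumes "finite S" "inj \<pi>" and R: "\<And>v w. (v, w) \<in> R \<Longrightarrow> v \<noteq> w \<and> {\<pi> v, \<pi> w} \<in> S"
  shows "card R \<le> 2 * card S"
proof -
  have "card R \<le> card (S \<times> (UNIV :: bool set))"
  proof (rule card_inj_on_le[of "\<lambda>(v, w). ({\<pi> v, \<pi> w}, v < w)"])
    show "inj_on (\<lambda>(v, w). ({\<pi> v, \<pi> w}, v < w)) R"
    proof (rule inj_onI, clarify)
      fix v w v' w'
      assume "(v, w) \<in> R" and eq: "{\<pi> v, \<pi> w} = {\<pi> v', \<pi> w'}" "(v < w) = (v' < w')"
      then have "v \<noteq> w" using R by blast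
      moreover have "v = v' \<and> w = w' \<or> v = w' \<and> w = v'"
        using eq(1) by (simp add: doubleton_eq_iff inj_eq[OF \<open>inj \<pi>\<close>])
      ultimately show "v = v' \<and> w = w'" using eq(2) by auto
    qed
  qed (use R \<open>finite S\<close> in auto)
  then show ?thesis by (simp add: card_cartesian_product)
qed

section \<open>The bitwise relation agrees with the block graph\<close>

lemma div_mod_bits: "j < q \<Longrightarrow> bit ((x mod 2 ^ (k + q)) div 2 ^ k) j = bit x (k + j)" for x :: nat
  by (simp add: bit_take_bit_iff bit_drop_bit_eq flip: take_bit_eq_mod drop_bit_eq_div)

lemma mod_div_less_16: "x mod 2 ^ (k + 4) div 2 ^ k < (16 :: nat)"
proof -
  have "x mod 2 ^ (k + 4) < 2 ^ (k + 4)" by simp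
  also have "\<dots> = 16 * 2 ^ k" by (simp add: power_add)
  finally show ?thesis by (rule less_mult_imp_div_less)
qed

lemma window_eq_iff:
  fixes t :: nat
  assumes i: "i = k + 4" and t: "t < 16"
  shows "window i x = (bit t 3, bit t 2, bit t 1, bit t 0) \<longleftrightarrow> x mod 2 ^ (k + 4) div 2 ^ k = t"
proof -
  define s where "s = x mod 2 ^ (k + 4) div 2 ^ k"
  have bits: "bit s 3 = bit x (k + 3)" "bit s 2 = bit x (k + 2)" "bit s 1 = bit x (k + 1)"
    "bit s 0 = bit x k"
    using div_mod_bits[of _ 4 x k] by (simp_all add: s_def)
  have w: "window i x = (bit s 3, bit s 2, bit s 1, bit s 0)"
    unfolding window_def bits i by (simp add: numeral_eq_Suc)
  have "s < 2 ^ 4"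
    using mod_div_less_16 by (simp add: s_def)
  moreover have "t < 2 ^ 4" using t by simp
  moreover have "i < 4 \<longleftrightarrow> i = 3 \<or> i = 2 \<or> i = 1 \<or> i = 0" for i :: nat by auto
  ultimately have "s = t \<longleftrightarrow> bit s 3 = bit t 3 \<and> bit s 2 = bit t 2 \<and> bit s 1 = bit t 1 \<and> bit s 0 = bit t 0"
    using eqI_below[of s 4 t] by auto
  then show ?thesis unfolding w by (simp add: s_def)
qed

text \<open>Eight digits, four for the block and four that lead the label, keep the subtractions
  from truncating, so that \<open>Y\<close> is a sixteenth of \<open>X\<close>.\<close>

lemma code_graph_blen:
  assumes "128 \<le> n"
  shows "code_graph (blen n - 4) n (2 ^ (blen n - 4)) (2 ^ (blen n - 8))" "8 \<le> blen n"
proof -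
  have "(2::nat) ^ 7 < 2 ^ blen n"
    using assms blen_bounds(2)[of n] by simp
  then have "7 < blen n" by (rule power_less_imp_less_exp[rotated]) simp
  then show "8 \<le> blen n" by simp
  then obtain k where k: "blen n = k + 8" by (metis le_Suc_ex add.commute)
  show "code_graph (blen n - 4) n (2 ^ (blen n - 4)) (2 ^ (blen n - 8))"
    using blen_bounds[of n] assms by unfold_locales (simp_all add: k power_add)
qed

lemma edge_rel_eq_adj:
  assumes n: "128 \<le> n" and uv: "u \<le> n" "v \<le> n"
  shows "edge_rel (blen n) u v = code_graph.adj (blen n - 4) (2 ^ (blen n - 4)) (2 ^ (blen n - 8)) u v"
proof -
  interpret code_graph "blen n - 4" n "2 ^ (blen n - 4)" "2 ^ (blen n - 8)"
    by (rule code_graph_blen[OF n])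
  obtain k where k: "blen n = k + 8"
    using code_graph_blen(2)[OF n] by (metis le_Suc_ex add.commute)
  have small: "x mod 2 ^ (k + 8) = x" "x div 2 ^ (k + 4) < 16" if "x \<le> n" for x
  proof -
    have "x < 2 ^ (k + 8)" using that blen_bounds(2)[of n] by (simp add: k)
    then show "x mod 2 ^ (k + 8) = x" "x div 2 ^ (k + 4) < 16"
      by (simp_all add: less_mult_imp_div_less power_add)
  qed
  have top: "window (k + 8) x = (bit t 3, bit t 2, bit t 1, bit t 0) \<longleftrightarrow> x div 2 ^ (k + 4) = t"
    if "x \<le> n" "t < 16" for x t :: nat
  proof -
    have "k + 8 = k + 4 + 4" by simp
    from window_eq_iff[OF this that(2), of x] show ?thesis
      using small(1)[OF that(1)] by (simp add: add.assoc)
  qed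
  have A: "window (k + 8) x = (False, False, False, False) \<longleftrightarrow> x div 2 ^ (k + 4) = 0" if "x \<le> n" for x
    using top[OF that, of 0] by simp
  have B: "window (k + 8) x = (False, False, False, True) \<longleftrightarrow> x div 2 ^ (k + 4) = 1" if "x \<le> n" for x
    using top[OF that, of 1] by (simp add: bit_Suc_0_iff)
  have mid: "window (k + 4) x = window (k + 8) y \<longleftrightarrow> x mod 2 ^ (k + 4) div 2 ^ k = y div 2 ^ (k + 4)"
    if "y \<le> n" for x y
  proof -
    define t where "t = y div 2 ^ (k + 4)"
    have "t < 16" using small(2)[OF that] by (simp add: t_def)
    with top[OF that this] have "window (k + 8) y = (bit t 3, bit t 2, bit t 1, bit t 0)"
      by (simp add: t_def)
    with window_eq_iff[of "k + 4" k t x] \<open>t < 16\<close> show ?thesis by (simp flip: t_def)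
  qed
  have k': "blen n - 4 = k + 4" "blen n - 8 = k" by (simp_all add: k)
  show ?thesis
    unfolding edge_rel_def adj_def Let_def unfolding k' unfolding k
    using uv by (simp only: A B mid cong: if_cong)
qed

section \<open>Robustness and density of the family\<close>

lemma edges_robust:
  assumes n: "2097152 \<le> n"
  shows "robustly_self_ordered (1 / 4194304 * real n) {1..n} (edges n)"
  unfolding robustly_self_ordered_def
proof (intro conjI allI impI)
  show "simple_graph {1..n} (edges n)" by (rule simple_graph_edges)
  show "0 < 1 / 4194304 * real n" using n by simp
  fix \<pi> assume \<pi>: "\<pi> permutes {1..n}"
  define X Y :: nat where "X = 2 ^ (blen n - 4)" and "Y = 2 ^ (blen n - 8)"
  have n128: "128 \<le> n" using n by simp
  interpret code_graph_permutation "blen n - 4" n X Y \<pi>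
    unfolding X_def Y_def
    by (intro code_graph_permutation.intro code_graph_blen[OF n128] code_graph_permutation_axioms.intro \<pi>)
  have edge: "{u, v} \<in> edges n \<longleftrightarrow> u \<noteq> v \<and> adj u v" if "u \<in> {1..n}" "v \<in> {1..n}" for u v
    using that in_edges_iff[OF that] edge_rel_eq_adj[OF n128, of u v] by (simp add: X_def Y_def)
  let ?\<Delta> = "sym_diff (edges n) (permute_edges \<pi> (edges n))"
  let ?moved = "{v \<in> {..n}. \<pi> v \<noteq> v}"
  let ?R = "{(v, w). v \<le> n \<and> w \<in> mismatches v \<and> v \<noteq> w}"
  have inj: "inj \<pi>" using \<pi> by (rule permutes_inj)
  have fin: "finite ?\<Delta>"
    using finite_edges by (simp add: permute_edges_def setcompr_eq_image)
  have "card ?R \<le> 2 * card ?\<Delta>"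
  proof (rule card_pairs_le[OF fin inj])
    fix v w assume "(v, w) \<in> ?R"
    then have vw: "v \<le> n" "w \<le> n" "adj v w \<noteq> adj (\<pi> v) (\<pi> w)" "v \<noteq> w"
      by (auto simp: mismatches_def)
    have "\<not> adj 0 x" "\<not> adj x 0" for x
      using X_pos by (simp_all add: adj_low adj_commute[of x 0])
    with vw(3) have "v \<noteq> 0" "w \<noteq> 0"
      using \<pi>_0 by metis+
    then have V: "v \<in> {1..n}" "w \<in> {1..n}" using vw by auto
    then have "\<pi> v \<in> {1..n}" "\<pi> w \<in> {1..n}"
      using permutes_in_image[OF \<pi>] by blast+
    then have "{\<pi> v, \<pi> w} \<in> edges n \<longleftrightarrow> adj (\<pi> v) (\<pi> w)"
      using edge vw by (simp add: \<pi>_eq_iff)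
    moreover have "{\<pi> v, \<pi> w} \<in> permute_edges \<pi> (edges n) \<longleftrightarrow> {v, w} \<in> edges n"
    proof -
      have "{\<pi> v, \<pi> w} = \<pi> ` {v, w}" by simp
      then show ?thesis
        by (auto simp: permute_edges_def inj_image_eq_iff[OF inj] simp del: image_insert)
    qed
    moreover have "{v, w} \<in> edges n \<longleftrightarrow> adj v w"
      using edge V vw by simp
    ultimately show "v \<noteq> w \<and> {\<pi> v, \<pi> w} \<in> ?\<Delta>"
      using vw by auto
  qed
  \<comment> \<open>\<open>mismatches\<close> also records loops, since \<open>adj v v\<close> can
    hold in A; a loop is violated only at a moved vertex.\<close>
  moreover have "(\<Sum>v\<le>n. card (mismatches v)) \<le> card ?R + card ?moved"
  proof -
    have finR: "finite ?R"
      by (rule finite_subset[of _ "{..n} \<times> {..n}"]) (auto simp: mismatches_def)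
    have "(\<Sum>v\<le>n. card (mismatches v)) = card (SIGMA v:{..n}. mismatches v)"
      by simp
    also have "\<dots> \<le> card (?R \<union> (\<lambda>v. (v, v)) ` ?moved)"
      by (rule card_mono) (use finR in \<open>auto simp: mismatches_def\<close>)
    also have "\<dots> \<le> card ?R + card ((\<lambda>v. (v, v)) ` ?moved)"
      by (rule card_Un_le)
    also have "card ((\<lambda>v. (v, v)) ` ?moved) = card ?moved"
      by (rule card_image) (simp add: inj_on_def)
    finally show ?thesis .
  qed
  ultimately have "Y * card ?moved \<le> 4096 * (2 * card ?\<Delta> + card ?moved)"
    using moved_le_mismatches by simp
  then have "real Y * card ?moved \<le> 8192 * card ?\<Delta> + 4096 * real (card ?moved)"
    using of_nat_mono[where 'a = real] by fastforce
  \<comment> \<open>As \<open>2097152 = 256 * 8192\<close>, \<open>Y\<close> exceeds 8192, so half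
    of the left side absorbs the loop term and the factor becomes 16384. Passing from
    \<open>Y\<close> to \<open>n\<close> costs another 256, and
    \<open>4194304 = 256 * 16384\<close>.\<close>
  moreover have Y: "n < 256 * Y" using n_upper XY by simp
  then have "8192 < Y" using n by simp
  then have "8192 * real (card ?moved) \<le> real Y * card ?moved"
    by (intro mult_right_mono) auto
  ultimately have "real Y * card ?moved \<le> 16384 * card ?\<Delta>" by simp
  moreover have "real n * card ?moved \<le> 256 * real Y * card ?moved"
    using Y by (intro mult_right_mono) auto
  ultimately have "real n * card ?moved \<le> 4194304 * card ?\<Delta>" by simp
  moreover have "{v \<in> {1..n}. \<pi> v \<noteq> v} = ?moved"
    by (auto simp: \<pi>_0 Suc_le_eq intro!: gr0I)
  ultimately show "1 / 4194304 * real n * real (card {v \<in> {1..n}. \<pi> v \<noteq> v}) \<le> real (card ?\<Delta>)"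
    by simp
qed

text \<open>Each vertex of B has degree at least \<open>5 * X\<close>. Without loops at least
  \<open>4 * X^2\<close> ordered pairs remain, hence \<open>2 * X^2\<close> edges, while
  \<open>n < 16 * X\<close>.\<close>

lemma edges_dense:
  assumes n: "128 \<le> n"
  shows "real n ^ 2 \<le> 128 * real (card (edges n))"
proof -
  define X Y :: nat where "X = 2 ^ (blen n - 4)" and "Y = 2 ^ (blen n - 8)"
  interpret code_graph "blen n - 4" n X Y
    unfolding X_def Y_def by (rule code_graph_blen[OF n])
  let ?S = "SIGMA u:{X..<2 * X}. {w \<in> {..n}. adj u w}"
  let ?R = "?S - (\<lambda>u. (u, u)) ` {X..<2 * X}"
  have edge: "{u, v} \<in> edges n \<longleftrightarrow> u \<noteq> v \<and> adj u v" if "u \<in> {1..n}" "v \<in> {1..n}" for u v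
    using that in_edges_iff[OF that] edge_rel_eq_adj[OF n, of u v] by (simp add: X_def Y_def)
  have "card ?R \<le> 2 * card (edges n)"
  proof (rule card_pairs_le[OF finite_edges, of "\<lambda>u. u"])
    fix v w assume vw: "(v, w) \<in> ?R"
    then have "w \<noteq> 0" using X_pos by (auto simp: adj_low adj_commute[of _ 0])
    with vw edge[of v w] X_pos n_lower show "v \<noteq> w \<and> {v, w} \<in> edges n" by auto
  qed simp
  moreover have "card ?S \<le> card ?R + card ((\<lambda>u. (u, u)) ` {X..<2 * X})"
    by (meson diff_card_le_card_Diff finite_atLeastLessThan finite_imageI le_diff_conv)
  moreover have "card ((\<lambda>u. (u, u)) ` {X..<2 * X}) = X"
    by (subst card_image) (auto simp: inj_on_def)
  moreover have "X * (5 * X) \<le> card ?S"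
  proof -
    have "X * (5 * X) = (\<Sum>u\<in>{X..<2 * X}. 5 * X)" by simp
    also have "\<dots> \<le> (\<Sum>u\<in>{X..<2 * X}. deg u)"
      by (rule sum_mono) (use deg_mid n_lower in fastforce)
    finally show ?thesis by (simp add: deg_def)
  qed
  moreover have "X \<le> X * X" using X_pos by simp
  ultimately have "2 * (X * X) \<le> card (edges n)" by linarith
  then have "2 * (real X * real X) \<le> real (card (edges n))"
    by (metis of_nat_le_iff of_nat_mult of_nat_numeral)
  moreover have "real n ^ 2 \<le> (16 * real X) ^ 2"
    using n_upper by (intro power_mono) auto
  ultimately show ?thesis by (simp add: power2_eq_square)
qed

theorem theorem1p4:
  shows "\<exists>(c::real) (E :: nat \<Rightarrow> nat set set) (M :: tm) (p :: real poly).
    0 < c \<and>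
    (\<forall>n. simple_graph {1..n} (E n)) \<and>
    (\<forall>\<^sub>F n in sequentially. robustly_self_ordered (c * real n) {1..n} (E n)) \<and>
    (\<lambda>n. real (card (E n))) \<in> \<Omega>(\<lambda>n. real n ^ 2) \<and>
    well_formed_tm M \<and>
    (\<forall>n. \<forall>u\<in>{1..n}. \<forall>v\<in>{1..n}.
       decides_within M (encode_triple n u v) ({u, v} \<in> E n) (poly p (log 2 (real n))))"
proof (intro exI conjI allI ballI)
  show "(0::real) < 1 / 4194304" by simp
  show "\<forall>\<^sub>F n in sequentially. robustly_self_ordered (1 / 4194304 * real n) {1..n} (edges n)"
    using edges_robust by (auto simp: eventually_sequentially)
  show "(\<lambda>n. real (card (edges n))) \<in> \<Omega>(\<lambda>n. real n ^ 2)"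
    by (rule landau_omega.bigI[of "1 / 128"]) 
      (use edges_dense in \<open>auto simp: eventually_sequentially mult.commute intro!: exI[of _ 128]\<close>)
  show "well_formed_tm (automaton_tm history_step (history 0 0 0) history_accepts)"
    by (rule well_formed_automaton_tm)
  show "simple_graph {1..n} (edges n)" for n
    by (rule simple_graph_edges)
  show "decides_within (automaton_tm history_step (history 0 0 0) history_accepts)
      (encode_triple n u v) ({u, v} \<in> edges n) (poly [:8, 4:] (log 2 (real n)))"
    if "u \<in> {1..n}" "v \<in> {1..n}" for n u v
    using that by (rule edges_decided)
qed

end
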